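(* (1) $\dim H^2(\bar{\mathcal{S}}^0,\mathbb{C})=4$, and $H^2(\bar{\mathcal{S}}^0,\mathbb{C})=\mathbb{C}\alpha_1\oplus\mathbb{C}\alpha_2\oplus\mathbb{C}\alpha_3\oplus\mathbb{C}\alpha_4$, where $\alpha_1,\dots,\alpha_4$ are (the classes of) the 2-cocycles given, for $m,n,r,s\in\mathbb{Z}$, by $$\alpha_1(L_m,L_n)=\tfrac{m^3-m}{12}\delta_{m+n,0};\qquad \alpha_2(L_m,W_n)=\delta_{m+n,0},\ \ \alpha_2(G_r,G_s)=\delta_{r+s,0};$$ $$\alpha_3(L_m,G_r)=(m^2+m)\delta_{m+r,0};\qquad \alpha_4(W_m,G_r)=\delta_{m+r,0}.$$ (2) $\dim H^2(\bar{\mathcal{S}}^{\frac12},\mathbb{C})=2$, and $H^2(\bar{\mathcal{S}}^{\frac12},\mathbb{C})=\mathbb{C}\beta_1\oplus\mathbb{C}\beta_2$, where $\beta_1,\beta_2$ are (the classes of) the 2-cocycles given, for $m,n\in\mathbb{Z}$, $r,s\in\mathbb{Z}+\frac12$, by $$\beta_1(L_m,L_n)=\tfrac{m^3-m}{12}\delta_{m+n,0};\qquad \beta_2(L_m,W_n)=\delta_{m+n,0},\ \ \beta_2(G_r,G_s)=\delta_{r+s,0}.$$ In each case, the values on pairs of basis elements not listed are determined by super skew-symmetry from the listed ones, and are zero otherwise.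
   Context: Everything is over $\mathbb{C}$. For $\epsilon\in\{0,\frac12\}$, $\bar{\mathcal{S}}^\epsilon$ is the Lie superalgebra with basis $\{L_m,W_m,G_r : m\in\mathbb{Z},\ r\in\mathbb{Z}+\epsilon\}$, $L_m,W_m$ even, $G_r$ odd, and super-brackets $$[L_m,L_n]=(n-m)L_{m+n},\quad [L_m,W_n]=(m+n)W_{m+n},\quad [L_m,G_r]=rG_{m+r},$$ $$[G_r,G_s]=(r+s)W_{r+s},\quad [W_m,W_n]=[W_m,G_r]=0.$$ A 2-cocycle on a Lie superalgebra $\mathfrak{g}$ is a $\mathbb{C}$-bilinear function $\psi:\mathfrak{g}\times\mathfrak{g}\to\mathbb{C}$ (not required to be even) such that for homogeneous $x,y,z$: $\psi(x,y)=-(-1)^{|x||y|}\psi(y,x)$ and $\psi(x,[y,z])=\psi([x,y],z)+(-1)^{|x||y|}\psi(y,[x,z])$. $C^2(\mathfrak{g},\mathbb{C})$ denotes the space of 2-cocycles. For any linear $f:\mathfrak{g}\to\mathbb{C}$, $\psi_f(x,y)=f([x,y])$ is a 2-cocycle called a 2-coboundary; $B^2(\mathfrak{g},\mathbb{C})$ is the space of 2-coboundaries, and $H^2(\mathfrak{g},\mathbb{C})=C^2(\mathfrak{g},\mathbb{C})/B^2(\mathfrak{g},\mathbb{C})$. *)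

theory Defs
  imports Complex_Main
begin

section \<open>Complex vector spaces\<close>

class complex_vector = ab_group_add +
  fixes scaleC :: "complex \<Rightarrow> 'a \<Rightarrow> 'a" (infixr \<open>*\<^sub>C\<close> 75)
  assumes scaleC_add_right: "c *\<^sub>C (x + y) = c *\<^sub>C x + c *\<^sub>C y"
    and scaleC_add_left: "(c + d) *\<^sub>C x = c *\<^sub>C x + d *\<^sub>C x"
    and scaleC_scaleC: "c *\<^sub>C d *\<^sub>C x = (c * d) *\<^sub>C x"
    and scaleC_one: "1 *\<^sub>C x = x"

global_interpretation complex_vector:
  vector_space "scaleC :: complex \<Rightarrow> 'a::complex_vector \<Rightarrow> 'a"
  by unfold_locales (rule scaleC_add_right scaleC_add_left scaleC_scaleC scaleC_one)+

lemma vector_space_complex: "vector_space ((*) :: complex \<Rightarrow> complex \<Rightarrow> complex)"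
  by unfold_locales (simp_all add: algebra_simps)

definition linear_form :: "('a::complex_vector \<Rightarrow> complex) \<Rightarrow> bool" where
  "linear_form f \<longleftrightarrow> Vector_Spaces.linear scaleC (*) f"

definition bilinear_form :: "('a::complex_vector \<Rightarrow> 'a \<Rightarrow> complex) \<Rightarrow> bool" where
  "bilinear_form \<psi> \<longleftrightarrow> (\<forall>x. linear_form (\<psi> x)) \<and> (\<forall>y. linear_form (\<lambda>x. \<psi> x y))"

lemma linear_form_iff:
  "linear_form f \<longleftrightarrow> (\<forall>x y. f (x + y) = f x + f y) \<and> (\<forall>c x. f (c *\<^sub>C x) = c * f x)"
  unfolding linear_form_def Vector_Spaces.linear_iff
  using complex_vector.vector_space_axioms vector_space_complex by auto


section \<open>Lie superalgebras and their second cohomology\<close>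

text \<open>Degrees in \<open>\<int>/2\<int>\<close> are represented by natural numbers modulo 2: \<open>hpart i\<close> is the
  even part if \<open>i\<close> is even and the odd part if \<open>i\<close> is odd.\<close>

class lie_superalgebra = complex_vector +
  fixes hpart :: "nat \<Rightarrow> 'a set"
    and bracket :: "'a \<Rightarrow> 'a \<Rightarrow> 'a"
  assumes hpart_mod2: "hpart (i mod 2) = hpart i"
    and hpart_zero: "0 \<in> hpart i"
    and hpart_add: "x \<in> hpart i \<Longrightarrow> y \<in> hpart i \<Longrightarrow> x + y \<in> hpart i"
    and hpart_scaleC: "x \<in> hpart i \<Longrightarrow> c *\<^sub>C x \<in> hpart i"
    and hpart_decomp: "\<exists>x0\<in>hpart 0. \<exists>x1\<in>hpart 1. x = x0 + x1"
    and hpart_disjoint: "hpart 0 \<inter> hpart 1 = {0}"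
    and bracket_add_left: "bracket (x + y) z = bracket x z + bracket y z"
    and bracket_add_right: "bracket x (y + z) = bracket x y + bracket x z"
    and bracket_scaleC_left: "bracket (c *\<^sub>C x) y = c *\<^sub>C bracket x y"
    and bracket_scaleC_right: "bracket x (c *\<^sub>C y) = c *\<^sub>C bracket x y"
    and bracket_hpart: "x \<in> hpart i \<Longrightarrow> y \<in> hpart j \<Longrightarrow> bracket x y \<in> hpart (i + j)"
    and bracket_skew: "x \<in> hpart i \<Longrightarrow> y \<in> hpart j \<Longrightarrow>
      bracket x y = - ((- 1) ^ (i * j) *\<^sub>C bracket y x)"
    and bracket_jacobi: "x \<in> hpart i \<Longrightarrow> y \<in> hpart j \<Longrightarrow> z \<in> hpart k \<Longrightarrow>
      bracket x (bracket y z) = bracket (bracket x y) z + (- 1) ^ (i * j) *\<^sub>C bracket y (bracket x z)"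

definition cocycles2 :: "('g::lie_superalgebra \<Rightarrow> 'g \<Rightarrow> complex) set" where
  "cocycles2 = {\<psi>. bilinear_form \<psi> \<and>
     (\<forall>i j x y. x \<in> hpart i \<longrightarrow> y \<in> hpart j \<longrightarrow> \<psi> x y = - ((- 1) ^ (i * j)) * \<psi> y x) \<and>
     (\<forall>i j k x y z. x \<in> hpart i \<longrightarrow> y \<in> hpart j \<longrightarrow> z \<in> hpart k \<longrightarrow>
        \<psi> x (bracket y z) = \<psi> (bracket x y) z + (- 1) ^ (i * j) * \<psi> y (bracket x z))}"

definition coboundaries2 :: "('g::lie_superalgebra \<Rightarrow> 'g \<Rightarrow> complex) set" where
  "coboundaries2 = {\<lambda>x y. f (bracket x y) |f. linear_form f}"

lemma coboundaries2_subset_cocycles2: "coboundaries2 \<subseteq> cocycles2"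
proof
  fix \<psi> :: "'g::lie_superalgebra \<Rightarrow> 'g \<Rightarrow> complex"
  assume "\<psi> \<in> coboundaries2"
  then obtain f where f: "linear_form f" and \<psi>: "\<psi> = (\<lambda>x y. f (bracket x y))"
    by (auto simp: coboundaries2_def)
  have add: "f (x + y) = f x + f y" and sc: "f (c *\<^sub>C x) = c * f x" for x y c
    using f by (auto simp: linear_form_iff)
  have neg: "f (- x) = - f x" for x
    using sc[of "-1" x] by (simp add: complex_vector.scale_minus_left)
  have "f (bracket x y) = - ((- 1) ^ (i * j)) * f (bracket y x)"
    if "x \<in> hpart i" "y \<in> hpart j" for i j x y
    by (subst bracket_skew[OF that]) (simp add: neg sc)
  moreover have "f (bracket x (bracket y z)) =
      f (bracket (bracket x y) z) + (- 1) ^ (i * j) * f (bracket y (bracket x z))"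
    if "x \<in> hpart i" "y \<in> hpart j" "z \<in> hpart k" for i j k x y z
    by (subst bracket_jacobi[OF that]) (simp add: add sc)
  moreover have "bilinear_form \<psi>"
    by (simp add: bilinear_form_def linear_form_iff \<psi> bracket_add_left bracket_add_right
        bracket_scaleC_left bracket_scaleC_right add sc)
  ultimately show "\<psi> \<in> cocycles2"
    unfolding cocycles2_def \<psi> by blast
qed

lemma cocycles2_zero: "(\<lambda>x y. 0) \<in> cocycles2"
  by (simp add: cocycles2_def bilinear_form_def linear_form_iff)

lemma cocycles2_add:
  assumes "\<phi> \<in> cocycles2" "\<psi> \<in> cocycles2"
  shows "(\<lambda>x y. \<phi> x y + \<psi> x y) \<in> cocycles2"
proof -
  have skew: "\<phi> x y = - ((- 1) ^ (i * j)) * \<phi> y x" "\<psi> x y = - ((- 1) ^ (i * j)) * \<psi> y x"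
    if "x \<in> hpart i" "y \<in> hpart j" for i j x y
    using assms that unfolding cocycles2_def by blast+
  have jac: "\<phi> x (bracket y z) = \<phi> (bracket x y) z + (- 1) ^ (i * j) * \<phi> y (bracket x z)"
    "\<psi> x (bracket y z) = \<psi> (bracket x y) z + (- 1) ^ (i * j) * \<psi> y (bracket x z)"
    if "x \<in> hpart i" "y \<in> hpart j" "z \<in> hpart k" for i j k x y z
    using assms that unfolding cocycles2_def by blast+
  have "bilinear_form \<phi>" "bilinear_form \<psi>"
    using assms unfolding cocycles2_def by blast+
  then have "bilinear_form (\<lambda>x y. \<phi> x y + \<psi> x y)"
    by (simp add: bilinear_form_def linear_form_iff algebra_simps)
  moreover have "\<phi> x y + \<psi> x y = - ((- 1) ^ (i * j)) * (\<phi> y x + \<psi> y x)"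
    if "x \<in> hpart i" "y \<in> hpart j" for i j x y
    using skew[OF that] by (simp only: distrib_left)
  moreover have "\<phi> x (bracket y z) + \<psi> x (bracket y z) = (\<phi> (bracket x y) z + \<psi> (bracket x y) z)
      + (- 1) ^ (i * j) * (\<phi> y (bracket x z) + \<psi> y (bracket x z))"
    if "x \<in> hpart i" "y \<in> hpart j" "z \<in> hpart k" for i j k x y z
    by (simp only: jac[OF that] distrib_left ac_simps)
  ultimately show ?thesis unfolding cocycles2_def by blast
qed

lemma cocycles2_scale:
  assumes "\<psi> \<in> cocycles2"
  shows "(\<lambda>x y. c * \<psi> x y) \<in> cocycles2"
proof -
  have skew: "\<psi> x y = - ((- 1) ^ (i * j)) * \<psi> y x"
    if "x \<in> hpart i" "y \<in> hpart j" for i j x y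
    using assms that unfolding cocycles2_def by blast
  have jac: "\<psi> x (bracket y z) = \<psi> (bracket x y) z + (- 1) ^ (i * j) * \<psi> y (bracket x z)"
    if "x \<in> hpart i" "y \<in> hpart j" "z \<in> hpart k" for i j k x y z
    using assms that unfolding cocycles2_def by blast
  have "bilinear_form \<psi>"
    using assms unfolding cocycles2_def by blast
  then have "bilinear_form (\<lambda>x y. c * \<psi> x y)"
    by (simp add: bilinear_form_def linear_form_iff algebra_simps)
  moreover have "c * \<psi> x y = - ((- 1) ^ (i * j)) * (c * \<psi> y x)"
    if "x \<in> hpart i" "y \<in> hpart j" for i j x y
    by (subst skew[OF that]) (simp only: mult.left_commute)
  moreover have "c * \<psi> x (bracket y z) =
      c * \<psi> (bracket x y) z + (- 1) ^ (i * j) * (c * \<psi> y (bracket x z))"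
    if "x \<in> hpart i" "y \<in> hpart j" "z \<in> hpart k" for i j k x y z
    by (simp only: jac[OF that] distrib_left ac_simps)
  ultimately show ?thesis unfolding cocycles2_def by blast
qed

lemma coboundaries2_zero: "(\<lambda>x y. 0) \<in> coboundaries2"
  unfolding coboundaries2_def mem_Collect_eq
  by (rule exI[of _ "\<lambda>x. 0"]) (simp add: linear_form_iff)

lemma coboundaries2_add:
  assumes "\<phi> \<in> coboundaries2" "\<psi> \<in> coboundaries2"
  shows "(\<lambda>x y. \<phi> x y + \<psi> x y) \<in> coboundaries2"
proof -
  obtain f g where "linear_form f" "\<phi> = (\<lambda>x y. f (bracket x y))"
    and "linear_form g" "\<psi> = (\<lambda>x y. g (bracket x y))"
    using assms by (auto simp: coboundaries2_def)
  then show ?thesis unfolding coboundaries2_def mem_Collect_eq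
    by (intro exI[of _ "\<lambda>x. f x + g x"]) (auto simp: linear_form_iff algebra_simps)
qed

lemma coboundaries2_scale:
  assumes "\<psi> \<in> coboundaries2"
  shows "(\<lambda>x y. c * \<psi> x y) \<in> coboundaries2"
proof -
  obtain f where "linear_form f" "\<psi> = (\<lambda>x y. f (bracket x y))"
    using assms by (auto simp: coboundaries2_def)
  then show ?thesis unfolding coboundaries2_def mem_Collect_eq
    by (intro exI[of _ "\<lambda>x. c * f x"]) (auto simp: linear_form_iff algebra_simps)
qed

definition cohomologous ::
  "('g::lie_superalgebra \<Rightarrow> 'g \<Rightarrow> complex) \<Rightarrow> ('g \<Rightarrow> 'g \<Rightarrow> complex) \<Rightarrow> bool" where
  "cohomologous \<phi> \<psi> \<longleftrightarrow>
     \<phi> \<in> cocycles2 \<and> \<psi> \<in> cocycles2 \<and> (\<lambda>x y. \<phi> x y - \<psi> x y) \<in> coboundaries2"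

lemma part_equivp_cohomologous: "part_equivp (cohomologous :: ('g::lie_superalgebra \<Rightarrow> 'g \<Rightarrow> complex) \<Rightarrow> _)"
  (is "part_equivp ?R")
proof (rule part_equivpI)
  show "\<exists>\<psi>. ?R \<psi> \<psi>"
    using cocycles2_zero coboundaries2_zero by (auto simp: cohomologous_def)
  show "symp ?R"
  proof (rule sympI)
    fix \<phi> \<psi> :: "'g \<Rightarrow> 'g \<Rightarrow> complex"
    assume "cohomologous \<phi> \<psi>"
    then show "cohomologous \<psi> \<phi>"
      using coboundaries2_scale[of "\<lambda>x y. \<phi> x y - \<psi> x y" "-1"] by (simp add: cohomologous_def)
  qed
  show "transp ?R"
  proof (rule transpI)
    fix \<phi> \<psi> \<chi> :: "'g \<Rightarrow> 'g \<Rightarrow> complex"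
    assume "cohomologous \<phi> \<psi>" "cohomologous \<psi> \<chi>"
    then show "cohomologous \<phi> \<chi>"
      using coboundaries2_add[of "\<lambda>x y. \<phi> x y - \<psi> x y" "\<lambda>x y. \<psi> x y - \<chi> x y"]
      by (simp add: cohomologous_def)
  qed
qed

text \<open>The quotient is taken of the subspace \<open>cocycles2\<close> of the space of all functions, hence the
  partial equivalence relation; \<open>H2_class \<psi>\<close> is the class of \<open>\<psi>\<close> only for
  \<open>\<psi> \<in> cocycles2\<close>.\<close>

quotient_type (overloaded) 'g H2 = "'g::lie_superalgebra \<Rightarrow> 'g \<Rightarrow> complex" / partial: cohomologous
  morphisms rep_H2 H2_class
  by (rule part_equivp_cohomologous)

lemma cohomologous_refl_iff: "cohomologous \<psi> \<psi> \<longleftrightarrow> \<psi> \<in> cocycles2"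
  by (simp add: cohomologous_def coboundaries2_zero)

instantiation H2 :: (lie_superalgebra) complex_vector
begin

lift_definition zero_H2 :: "'a H2" is "\<lambda>x y. 0"
  by (simp add: cohomologous_def cocycles2_zero coboundaries2_zero)

lift_definition plus_H2 :: "'a H2 \<Rightarrow> 'a H2 \<Rightarrow> 'a H2" is "\<lambda>\<phi> \<psi> x y. \<phi> x y + \<psi> x y"
  subgoal for \<phi> \<phi>' \<psi> \<psi>'
    using coboundaries2_add[of "\<lambda>x y. \<phi> x y - \<phi>' x y" "\<lambda>x y. \<psi> x y - \<psi>' x y"]
    by (simp add: cohomologous_def cocycles2_add add_diff_add)
  done

lift_definition scaleC_H2 :: "complex \<Rightarrow> 'a H2 \<Rightarrow> 'a H2" is "\<lambda>c \<psi> x y. c * \<psi> x y"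
  subgoal for c \<phi> \<psi>
    using coboundaries2_scale[of "\<lambda>x y. \<phi> x y - \<psi> x y" c]
    by (simp add: cohomologous_def cocycles2_scale right_diff_distrib)
  done

definition uminus_H2 :: "'a H2 \<Rightarrow> 'a H2" where "uminus_H2 h = (- 1) *\<^sub>C h"

definition minus_H2 :: "'a H2 \<Rightarrow> 'a H2 \<Rightarrow> 'a H2" where "minus_H2 h k = h + - k"

instance
proof
  fix a b c :: "'a H2" and u v :: complex
  show "a + b + c = a + (b + c)"
    by transfer (simp add: add.assoc cohomologous_refl_iff cocycles2_add)
  show "a + b = b + a"
    by transfer (simp add: add.commute cohomologous_refl_iff cocycles2_add)
  show "0 + a = a"
    by transfer (simp add: cohomologous_refl_iff)
  show "- a + a = 0"
    unfolding uminus_H2_def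
    by transfer (simp add: cohomologous_refl_iff cocycles2_zero)
  show "a - b = a + - b"
    by (simp add: minus_H2_def)
  show "u *\<^sub>C (a + b) = u *\<^sub>C a + u *\<^sub>C b"
    by transfer (simp add: distrib_left cohomologous_refl_iff cocycles2_add cocycles2_scale)
  show "(u + v) *\<^sub>C a = u *\<^sub>C a + v *\<^sub>C a"
    by transfer (simp add: distrib_right cohomologous_refl_iff cocycles2_add cocycles2_scale)
  show "u *\<^sub>C v *\<^sub>C a = (u * v) *\<^sub>C a"
    by transfer (simp add: mult.assoc[symmetric] cohomologous_refl_iff cocycles2_scale)
  show "1 *\<^sub>C a = a"
    by transfer (simp add: cohomologous_refl_iff)
qed

end


section \<open>The Lie superalgebras\<close>

text \<open>The index set \<open>\<int> + \<epsilon>\<close> of the odd generators is a type: \<open>int\<close> for \<open>\<epsilon> = 0\<close> and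
  \<open>half_int\<close> for \<open>\<epsilon> = 1/2\<close>.\<close>

class gindex =
  fixes gval :: "'a \<Rightarrow> real"
  assumes inj_gval: "inj gval"
    and range_gval: "\<exists>\<epsilon>\<in>{0, 1/2}. range gval = {real_of_int k + \<epsilon> |k. True}"

instantiation int :: gindex
begin

definition gval_int :: "int \<Rightarrow> real" where "gval_int = real_of_int"

instance
  by standard (auto simp: gval_int_def inj_def)

end

typedef half_int = "{real_of_int k + 1/2 |k. True}"
  by blast

instantiation half_int :: gindex
begin

definition gval_half_int :: "half_int \<Rightarrow> real" where "gval_half_int = Rep_half_int"

instance
proof
  show "inj (gval :: half_int \<Rightarrow> real)"
    by (simp add: gval_half_int_def inj_def Rep_half_int_inject)
  show "\<exists>\<epsilon>\<in>{0, 1/2}. range (gval :: half_int \<Rightarrow> real) = {real_of_int k + \<epsilon> |k. True}"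
    using type_definition.Rep_range[OF type_definition_half_int] by (simp add: gval_half_int_def)
qed

end

text \<open>\<open>gshift m r\<close> is the index \<open>m + r\<close>, and \<open>gsum r s\<close> is \<open>r + s\<close>, which is an integer
  (\<open>gval_gshift\<close> and \<open>of_int_gsum\<close> below).\<close>

definition gshift :: "int \<Rightarrow> 'r::gindex \<Rightarrow> 'r" where
  "gshift m r = inv gval (real_of_int m + gval r)"

definition gsum :: "'r::gindex \<Rightarrow> 'r \<Rightarrow> int" where
  "gsum r s = \<lfloor>gval r + gval s\<rfloor>"

lemma gval_gshift: "gval (gshift m r) = real_of_int m + gval (r::'r::gindex)"
proof -
  obtain \<epsilon> where e: "range (gval::'r \<Rightarrow> real) = {real_of_int k + \<epsilon> |k. True}"
    using range_gval by blast
  then obtain k where "gval r = real_of_int k + \<epsilon>" by blast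
  then have "real_of_int m + gval r = real_of_int (m + k) + \<epsilon>" by simp
  then have "real_of_int m + gval r \<in> range (gval::'r \<Rightarrow> real)" unfolding e by blast
  then show ?thesis unfolding gshift_def by (rule f_inv_into_f)
qed

lemma of_int_gsum: "real_of_int (gsum r s) = gval r + gval (s::'r::gindex)"
proof -
  obtain \<epsilon> where \<epsilon>: "\<epsilon> \<in> {0, 1/2}" "range (gval::'r \<Rightarrow> real) = {real_of_int k + \<epsilon> |k. True}"
    using range_gval by blast
  then obtain k l where "gval r = real_of_int k + \<epsilon>" "gval s = real_of_int l + \<epsilon>" by blast
  then have "gval r + gval s = real_of_int (k + l + (if \<epsilon> = 0 then 0 else 1))"
    using \<epsilon>(1) by auto
  then show ?thesis unfolding gsum_def by (metis floor_of_int)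
qed

datatype 'r sgen = L int | W int | G 'r

primrec sdeg :: "'r sgen \<Rightarrow> nat" where
  "sdeg (L m) = 0"
| "sdeg (W m) = 0"
| "sdeg (G r) = 1"

text \<open>The free complex vector space on \<open>'r sgen\<close>.\<close>

typedef 'r sbar = "{f :: 'r sgen \<Rightarrow> complex. finite {b. f b \<noteq> 0}}"
  morphisms coord Abs_sbar
  by (rule exI[of _ "\<lambda>_. 0"]) simp

setup_lifting type_definition_sbar

lift_definition bvec :: "'r sgen \<Rightarrow> 'r sbar" is "\<lambda>b c. of_bool (c = b)"
  by simp

definition supp :: "'r sbar \<Rightarrow> 'r sgen set" where
  "supp x = {b. coord x b \<noteq> 0}"

instantiation sbar :: (type) complex_vector
begin

lift_definition zero_sbar :: "'a sbar" is "\<lambda>b. 0" by simp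

lift_definition plus_sbar :: "'a sbar \<Rightarrow> 'a sbar \<Rightarrow> 'a sbar" is "\<lambda>f g b. f b + g b"
  subgoal for f g by (rule finite_subset[of _ "{b. f b \<noteq> 0} \<union> {b. g b \<noteq> 0}"]) auto
  done

lift_definition uminus_sbar :: "'a sbar \<Rightarrow> 'a sbar" is "\<lambda>f b. - f b" by simp

lift_definition minus_sbar :: "'a sbar \<Rightarrow> 'a sbar \<Rightarrow> 'a sbar" is "\<lambda>f g b. f b - g b"
  subgoal for f g by (rule finite_subset[of _ "{b. f b \<noteq> 0} \<union> {b. g b \<noteq> 0}"]) auto
  done

lift_definition scaleC_sbar :: "complex \<Rightarrow> 'a sbar \<Rightarrow> 'a sbar" is "\<lambda>c f b. c * f b"
  subgoal for c f by (rule finite_subset[of _ "{b. f b \<noteq> 0}"]) auto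
  done

instance
  by standard (transfer; auto simp: algebra_simps)+

end

lemma finite_supp: "finite (supp x)"
  unfolding supp_def by transfer

lemma finite_coord: "finite {b. coord x b \<noteq> 0}"
  by transfer

lemma coord_zero: "coord 0 b = 0"
  by (simp add: zero_sbar.rep_eq)

lemma coord_sum: "coord (sum v A) b = (\<Sum>a\<in>A. coord (v a) b)"
  by (induction A rule: infinite_finite_induct) (simp_all add: coord_zero plus_sbar.rep_eq)

lemma sbar_eq_sum_bvec:
  assumes "finite A" "supp x \<subseteq> A"
  shows "x = (\<Sum>a\<in>A. coord x a *\<^sub>C bvec a)"
proof -
  have "coord x b = coord (\<Sum>a\<in>A. coord x a *\<^sub>C bvec a) b" for b
  proof -
    have "coord (\<Sum>a\<in>A. coord x a *\<^sub>C bvec a) b = (\<Sum>a\<in>A. if b = a then coord x a else 0)"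
      unfolding coord_sum by (rule sum.cong) (auto simp: scaleC_sbar.rep_eq bvec.rep_eq)
    also have "\<dots> = (if b \<in> A then coord x b else 0)"
      by (rule sum.delta'[OF assms(1)])
    also have "\<dots> = coord x b"
      using assms(2) by (auto simp: supp_def)
    finally show ?thesis by simp
  qed
  then show ?thesis
    by (metis coord_inject ext)
qed

fun basis_bracket :: "'r::gindex sgen \<Rightarrow> 'r sgen \<Rightarrow> 'r sbar" where
  "basis_bracket (L m) (L n) = of_int (n - m) *\<^sub>C bvec (L (m + n))"
| "basis_bracket (L m) (W n) = of_int (m + n) *\<^sub>C bvec (W (m + n))"
| "basis_bracket (W m) (L n) = - (of_int (m + n) *\<^sub>C bvec (W (m + n)))"
| "basis_bracket (L m) (G r) = of_real (gval r) *\<^sub>C bvec (G (gshift m r))"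
| "basis_bracket (G r) (L m) = - (of_real (gval r) *\<^sub>C bvec (G (gshift m r)))"
| "basis_bracket (G r) (G s) = of_real (gval r + gval s) *\<^sub>C bvec (W (gsum r s))"
| "basis_bracket (W m) (W n) = 0"
| "basis_bracket (W m) (G r) = 0"
| "basis_bracket (G r) (W m) = 0"

definition sbracket :: "'r::gindex sbar \<Rightarrow> 'r sbar \<Rightarrow> 'r sbar" where
  "sbracket x y = (\<Sum>a\<in>supp x. \<Sum>b\<in>supp y. (coord x a * coord y b) *\<^sub>C basis_bracket a b)"

lemma sbracket_superset:
  assumes "finite A" "supp x \<subseteq> A" "finite B" "supp y \<subseteq> B"
  shows "sbracket x y = (\<Sum>a\<in>A. \<Sum>b\<in>B. (coord x a * coord y b) *\<^sub>C basis_bracket a b)"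
proof -
  have "(\<Sum>b\<in>supp y. (coord x a * coord y b) *\<^sub>C basis_bracket a b)
      = (\<Sum>b\<in>B. (coord x a * coord y b) *\<^sub>C basis_bracket a b)" for a
    using assms by (intro sum.mono_neutral_left) (auto simp: supp_def)
  moreover have "(\<Sum>a\<in>supp x. \<Sum>b\<in>B. (coord x a * coord y b) *\<^sub>C basis_bracket a b)
      = (\<Sum>a\<in>A. \<Sum>b\<in>B. (coord x a * coord y b) *\<^sub>C basis_bracket a b)"
    using assms by (intro sum.mono_neutral_left) (auto simp: supp_def)
  ultimately show ?thesis unfolding sbracket_def by simp
qed

lemma sbracket_bvec: "sbracket (bvec a) (bvec b) = basis_bracket a b"
  by (subst sbracket_superset[of "{a}" _ "{b}"]) (auto simp: supp_def bvec.rep_eq scaleC_one)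

lemma sbracket_add_left: "sbracket (x + y) z = sbracket x z + sbracket y z"
  by (subst (1 2 3) sbracket_superset[of "supp x \<union> supp y" _ "supp z"])
    (auto simp: finite_coord supp_def plus_sbar.rep_eq distrib_right scaleC_add_left sum.distrib)

lemma sbracket_add_right: "sbracket x (y + z) = sbracket x y + sbracket x z"
  by (subst (1 2 3) sbracket_superset[of "supp x" _ "supp y \<union> supp z"])
    (auto simp: finite_coord supp_def plus_sbar.rep_eq distrib_left scaleC_add_left sum.distrib)

lemma sbracket_scaleC_left: "sbracket (c *\<^sub>C x) y = c *\<^sub>C sbracket x y"
  by (subst (1 2) sbracket_superset[of "supp x" _ "supp y"])
    (auto simp: finite_coord supp_def scaleC_sbar.rep_eq complex_vector.scale_sum_right
      scaleC_scaleC mult_ac)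

lemma sbracket_scaleC_right: "sbracket x (c *\<^sub>C y) = c *\<^sub>C sbracket x y"
  by (subst (1 2) sbracket_superset[of "supp x" _ "supp y"])
    (auto simp: finite_coord supp_def scaleC_sbar.rep_eq complex_vector.scale_sum_right
      scaleC_scaleC mult_ac)

definition shpart :: "nat \<Rightarrow> 'r sbar set" where
  "shpart i = {x. \<forall>b\<in>supp x. sdeg b = i mod 2}"

lemma complex_vector_subspace_shpart: "complex_vector.subspace (shpart i)"
  unfolding complex_vector.subspace_def shpart_def supp_def
  by (auto simp: zero_sbar.rep_eq plus_sbar.rep_eq scaleC_sbar.rep_eq) (metis add_0)

lemma shpart_induct [consumes 1, case_names zero add scale basis]:
  assumes x: "x \<in> shpart i"
    and "P 0" "\<And>x y. P x \<Longrightarrow> P y \<Longrightarrow> P (x + y)" "\<And>c x. P x \<Longrightarrow> P (c *\<^sub>C x)"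
    and basis: "\<And>a. sdeg a = i mod 2 \<Longrightarrow> P (bvec a)"
  shows "P x"
proof -
  have "P (\<Sum>a\<in>A. coord x a *\<^sub>C bvec a)" if "finite A" "A \<subseteq> supp x" for A
    using that by (induction A) (use x assms(2-5) in \<open>auto simp: shpart_def\<close>)
  then show ?thesis
    using sbar_eq_sum_bvec[of "supp x" x] finite_supp[of x] by (metis order_refl)
qed

lemma basis_bracket_shpart:
  "basis_bracket a b \<in> shpart (sdeg a + sdeg (b::'r::gindex sgen))"
  by (cases a; cases b)
    (auto simp: shpart_def supp_def coord_zero uminus_sbar.rep_eq scaleC_sbar.rep_eq bvec.rep_eq)

lemma basis_bracket_skew:
  "basis_bracket a b = - ((- 1) ^ (sdeg a * sdeg b) *\<^sub>C basis_bracket b (a::'r::gindex sgen))"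
proof (cases a; cases b)
  fix r s :: 'r
  assume "a = G r" "b = G s"
  then show ?thesis
    by (simp add: gsum_def add.commute flip: complex_vector.scale_minus_left)
qed (simp_all add: add.commute complex_vector.scale_minus_left scaleC_one scaleC_scaleC
      flip: complex_vector.scale_minus_left)

lemma gshift_gshift: "gshift m (gshift n r) = gshift (m + n) (r::'r::gindex)"
  by (rule injD[OF inj_gval]) (simp add: gval_gshift)

lemma gsum_gshift:
  "gsum (gshift m r) s = m + gsum r (s::'r::gindex)"
  "gsum r (gshift m s) = m + gsum r (s::'r::gindex)"
  by (simp_all flip: of_int_eq_iff[where 'a = real] add: of_int_gsum gval_gshift)

lemma sbracket_minus:
  "sbracket (- x) y = - sbracket x y" "sbracket x (- y) = - sbracket x y"
  using sbracket_scaleC_left[of "-1" x y] sbracket_scaleC_right[of x "-1" y]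
  by (simp_all add: complex_vector.scale_minus_left scaleC_one)

lemma sbracket_diff:
  "sbracket (x - y) z = sbracket x z - sbracket y z"
  "sbracket x (y - z) = sbracket x y - sbracket x z"
  using sbracket_add_left[of x "- y" z] sbracket_add_right[of x y "- z"]
  by (simp_all add: sbracket_minus)

lemma sbracket_zero: "sbracket 0 y = 0" "sbracket x 0 = 0"
  by (simp_all add: sbracket_def supp_def coord_zero)

lemma of_int_gsum_complex:
  "of_int (gsum r s) = complex_of_real (gval r) + complex_of_real (gval (s::'r::gindex))"
  using of_int_gsum[of r s] by (metis of_real_add of_real_of_int_eq)

lemma gsum_commute: "gsum r s = gsum s r"
  by (simp add: gsum_def add.commute)

lemma basis_jacobi:
  "sbracket (bvec a) (basis_bracket b c) = sbracket (basis_bracket a b) (bvec c) +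
     (- 1) ^ (sdeg a * sdeg b) *\<^sub>C sbracket (bvec b) (basis_bracket a (c::'r::gindex sgen))"
  by (cases a; cases b; cases c)
    (simp_all add: sbracket_bvec sbracket_zero sbracket_minus sbracket_diff
      sbracket_add_left sbracket_add_right sbracket_scaleC_left
      sbracket_scaleC_right scaleC_scaleC gshift_gshift gsum_gshift gval_gshift
      of_int_gsum_complex gsum_commute algebra_simps complex_vector.scale_left_distrib
      complex_vector.scale_left_diff_distrib)

lemma sign_mod2: "(- 1 :: complex) ^ ((i mod 2) * (j mod 2)) = (- 1) ^ (i * j)"
  by (simp add: uminus_power_if)

lemma shpart_mod2: "shpart (i mod 2) = shpart i"
  by (simp add: shpart_def)

lemma sbracket_skew:
  fixes x y :: "'r::gindex sbar"
  assumes "x \<in> shpart i" "y \<in> shpart j"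
  shows "sbracket x y = - ((- 1) ^ (i * j) *\<^sub>C sbracket y x)"
  using assms(1)
proof (induction x rule: shpart_induct)
  case (basis a)
  show ?case
    using assms(2)
  proof (induction y rule: shpart_induct)
    case (basis b)
    show ?case
      unfolding sbracket_bvec sign_mod2[of i j, symmetric]
        \<open>sdeg a = i mod 2\<close>[symmetric] \<open>sdeg b = j mod 2\<close>[symmetric]
      by (rule basis_bracket_skew)
  qed (simp_all add: sbracket_zero sbracket_add_left sbracket_add_right sbracket_scaleC_left
      sbracket_scaleC_right scaleC_add_right scaleC_scaleC mult.commute)
qed (simp_all add: sbracket_zero sbracket_add_left sbracket_add_right sbracket_scaleC_left
      sbracket_scaleC_right scaleC_add_right scaleC_scaleC mult.commute)

lemma sbracket_jacobi:
  fixes x y z :: "'r::gindex sbar"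
  assumes "x \<in> shpart i" "y \<in> shpart j" "z \<in> shpart k"
  shows "sbracket x (sbracket y z) =
    sbracket (sbracket x y) z + (- 1) ^ (i * j) *\<^sub>C sbracket y (sbracket x z)"
  using assms(1)
proof (induction x rule: shpart_induct)
  case (basis a)
  show ?case
    using assms(2)
  proof (induction y rule: shpart_induct)
    case (basis b)
    show ?case
      using assms(3)
    proof (induction z rule: shpart_induct)
      case (basis c)
      show ?case
        unfolding sbracket_bvec sign_mod2[of i j, symmetric]
          \<open>sdeg a = i mod 2\<close>[symmetric] \<open>sdeg b = j mod 2\<close>[symmetric]
        by (rule basis_jacobi)
    qed (simp_all add: sbracket_zero sbracket_add_left sbracket_add_right sbracket_scaleC_left
        sbracket_scaleC_right scaleC_add_right scaleC_scaleC mult.commute)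
  qed (simp_all add: sbracket_zero sbracket_add_left sbracket_add_right sbracket_scaleC_left
      sbracket_scaleC_right scaleC_add_right scaleC_scaleC mult.commute)
qed (simp_all add: sbracket_zero sbracket_add_left sbracket_add_right sbracket_scaleC_left
      sbracket_scaleC_right scaleC_add_right scaleC_scaleC mult.commute)

lemma sbracket_shpart:
  fixes x y :: "'r::gindex sbar"
  assumes "x \<in> shpart i" "y \<in> shpart j"
  shows "sbracket x y \<in> shpart (i + j)"
  using assms(1)
proof (induction x rule: shpart_induct)
  case (basis a)
  show ?case
    using assms(2)
  proof (induction y rule: shpart_induct)
    case (basis b)
    have "shpart (sdeg a + sdeg b) = (shpart (i + j) :: 'r sbar set)"
      using basis \<open>sdeg a = i mod 2\<close> by (metis mod_add_eq shpart_mod2)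
    then show ?case
      unfolding sbracket_bvec using basis_bracket_shpart[of a b] by (simp only:)
  qed (simp_all add: sbracket_zero sbracket_add_right sbracket_scaleC_right
      complex_vector.subspace_0 complex_vector.subspace_add complex_vector.subspace_scale
      complex_vector_subspace_shpart)
qed (simp_all add: sbracket_zero sbracket_add_left sbracket_scaleC_left
      complex_vector.subspace_0 complex_vector.subspace_add complex_vector.subspace_scale
      complex_vector_subspace_shpart)

lemma shpart_decomp:
  fixes x :: "'r sbar"
  shows "\<exists>x0\<in>shpart 0. \<exists>x1\<in>shpart 1. x = x0 + x1"
proof -
  have fin: "finite {b. (if P b then coord x b else 0) \<noteq> 0}" for P
    by (rule finite_subset[OF _ finite_supp[of x]]) (auto simp: supp_def)
  define x0 where "x0 = Abs_sbar (\<lambda>b. if sdeg b = 0 then coord x b else 0)"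
  define x1 where "x1 = Abs_sbar (\<lambda>b. if sdeg b \<noteq> 0 then coord x b else 0)"
  have c0: "coord x0 = (\<lambda>b. if sdeg b = 0 then coord x b else 0)"
    unfolding x0_def by (rule Abs_sbar_inverse) (use fin[of "\<lambda>b. sdeg b = 0"] in simp)
  have c1: "coord x1 = (\<lambda>b. if sdeg b \<noteq> 0 then coord x b else 0)"
    unfolding x1_def by (rule Abs_sbar_inverse) (use fin[of "\<lambda>b. sdeg b \<noteq> 0"] in simp)
  have sdeg: "sdeg b > 0 \<Longrightarrow> sdeg b = Suc 0" for b :: "'r sgen" by (cases b) auto
  have "x0 \<in> shpart 0" "x1 \<in> shpart 1"
    by (auto simp: shpart_def supp_def c0 c1 sdeg)
  moreover have "x = x0 + x1"
    by (rule coord_inject[THEN iffD1], rule ext) (simp add: plus_sbar.rep_eq c0 c1)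
  ultimately show ?thesis by blast
qed

lemma shpart_disjoint: "shpart 0 \<inter> shpart 1 = {0}"
proof -
  have "x = 0" if "x \<in> shpart 0" "x \<in> shpart 1" for x :: "'a sbar"
  proof (rule coord_inject[THEN iffD1], rule ext)
    fix b show "coord x b = coord 0 b"
      using that by (auto simp: shpart_def supp_def coord_zero)
  qed
  then show ?thesis
    by (auto simp: complex_vector.subspace_0 complex_vector_subspace_shpart)
qed

instantiation sbar :: (gindex) lie_superalgebra
begin

definition hpart_sbar :: "nat \<Rightarrow> 'a sbar set" where "hpart_sbar = shpart"

definition bracket_sbar :: "'a sbar \<Rightarrow> 'a sbar \<Rightarrow> 'a sbar" where "bracket_sbar = sbracket"

instance
proof
  fix x y z :: "'a sbar" and c :: complex and i j k :: nat
  show "hpart (i mod 2) = (hpart i :: 'a sbar set)"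
    by (simp add: hpart_sbar_def shpart_mod2)
  show "0 \<in> (hpart i :: 'a sbar set)"
    by (simp add: hpart_sbar_def complex_vector.subspace_0 complex_vector_subspace_shpart)
  show "x \<in> hpart i \<Longrightarrow> y \<in> hpart i \<Longrightarrow> x + y \<in> hpart i"
    by (simp add: hpart_sbar_def complex_vector.subspace_add complex_vector_subspace_shpart)
  show "x \<in> hpart i \<Longrightarrow> c *\<^sub>C x \<in> hpart i"
    by (simp add: hpart_sbar_def complex_vector.subspace_scale complex_vector_subspace_shpart)
  show "\<exists>x0\<in>hpart 0. \<exists>x1\<in>hpart 1. x = x0 + x1"
    unfolding hpart_sbar_def by (rule shpart_decomp)
  show "hpart 0 \<inter> hpart 1 = {0 :: 'a sbar}"
    unfolding hpart_sbar_def by (rule shpart_disjoint)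
  show "x \<in> hpart i \<Longrightarrow> y \<in> hpart j \<Longrightarrow> bracket x y \<in> hpart (i + j)"
    unfolding hpart_sbar_def bracket_sbar_def by (rule sbracket_shpart)
  show "x \<in> hpart i \<Longrightarrow> y \<in> hpart j \<Longrightarrow> bracket x y = - ((- 1) ^ (i * j) *\<^sub>C bracket y x)"
    unfolding hpart_sbar_def bracket_sbar_def by (rule sbracket_skew)
  show "x \<in> hpart i \<Longrightarrow> y \<in> hpart j \<Longrightarrow> z \<in> hpart k \<Longrightarrow>
      bracket x (bracket y z) = bracket (bracket x y) z + (- 1) ^ (i * j) *\<^sub>C bracket y (bracket x z)"
    unfolding hpart_sbar_def bracket_sbar_def by (rule sbracket_jacobi)
qed (simp_all add: bracket_sbar_def sbracket_add_left sbracket_add_right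
    sbracket_scaleC_left sbracket_scaleC_right)

end

lemma bracket_bvec: "bracket (bvec a) (bvec b) = basis_bracket a b"
  by (simp add: bracket_sbar_def sbracket_bvec)

type_synonym sbar_zero = "int sbar"
type_synonym sbar_half = "half_int sbar"

text \<open>The bilinear form with prescribed values \<open>v\<close> on pairs of basis vectors.\<close>

definition bilinear_ext :: "('r sgen \<Rightarrow> 'r sgen \<Rightarrow> complex) \<Rightarrow> 'r sbar \<Rightarrow> 'r sbar \<Rightarrow> complex" where
  "bilinear_ext v x y = (\<Sum>a\<in>supp x. \<Sum>b\<in>supp y. coord x a * coord y b * v a b)"

lemma bilinear_ext_bvec: "bilinear_ext v (bvec a) (bvec b) = v a b"
proof -
  have "supp (bvec c) = {c}" for c :: "'a sgen"
    by (auto simp: supp_def bvec.rep_eq)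
  then show ?thesis by (simp add: bilinear_ext_def bvec.rep_eq)
qed

text \<open>The equations with a minus sign are the values forced by super skew-symmetry
  (\<open>L\<close>, \<open>W\<close> even, \<open>G\<close> odd).\<close>

fun alpha1_basis :: "int sgen \<Rightarrow> int sgen \<Rightarrow> complex" where
  "alpha1_basis (L m) (L n) = (of_int m ^ 3 - of_int m) / 12 * of_bool (m + n = 0)"
| "alpha1_basis _ _ = 0"

fun alpha2_basis :: "int sgen \<Rightarrow> int sgen \<Rightarrow> complex" where
  "alpha2_basis (L m) (W n) = of_bool (m + n = 0)"
| "alpha2_basis (W n) (L m) = - of_bool (m + n = 0)"
| "alpha2_basis (G r) (G s) = of_bool (r + s = 0)"
| "alpha2_basis _ _ = 0"

fun alpha3_basis :: "int sgen \<Rightarrow> int sgen \<Rightarrow> complex" where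
  "alpha3_basis (L m) (G r) = (of_int m ^ 2 + of_int m) * of_bool (m + r = 0)"
| "alpha3_basis (G r) (L m) = - ((of_int m ^ 2 + of_int m) * of_bool (m + r = 0))"
| "alpha3_basis _ _ = 0"

fun alpha4_basis :: "int sgen \<Rightarrow> int sgen \<Rightarrow> complex" where
  "alpha4_basis (W m) (G r) = of_bool (m + r = 0)"
| "alpha4_basis (G r) (W m) = - of_bool (m + r = 0)"
| "alpha4_basis _ _ = 0"

fun beta1_basis :: "half_int sgen \<Rightarrow> half_int sgen \<Rightarrow> complex" where
  "beta1_basis (L m) (L n) = (of_int m ^ 3 - of_int m) / 12 * of_bool (m + n = 0)"
| "beta1_basis _ _ = 0"

fun beta2_basis :: "half_int sgen \<Rightarrow> half_int sgen \<Rightarrow> complex" where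
  "beta2_basis (L m) (W n) = of_bool (m + n = 0)"
| "beta2_basis (W n) (L m) = - of_bool (m + n = 0)"
| "beta2_basis (G r) (G s) = of_bool (gval r + gval s = 0)"
| "beta2_basis _ _ = 0"

definition "\<alpha>1 = bilinear_ext alpha1_basis"
definition "\<alpha>2 = bilinear_ext alpha2_basis"
definition "\<alpha>3 = bilinear_ext alpha3_basis"
definition "\<alpha>4 = bilinear_ext alpha4_basis"
definition "\<beta>1 = bilinear_ext beta1_basis"
definition "\<beta>2 = bilinear_ext beta2_basis"

end

(* The bracket with L_0 is the grading, so invariance under L_0 makes every cocycle cohomologous to
   one of weight zero, i.e. supported on pairs of basis vectors with opposite weights. The remaining
   freedom in f(L_0) and f(G_0) kills the values on (L_1, L_-1) and (L_-1, G_1). The Jacobi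
   identities then become functional equations for the sequences of values on (L_m, L_-m),
   (L_m, W_-m), (L_m, G_-m), (W_m, G_-m), (G_r, G_-r), whose solutions are m^3 - m, a constant,
   m^2 + m, a constant, and the constant of (L_m, W_-m). For half-integral odd indices the two mixed
   odd families do not occur in weight zero. *)

theory Submission
  imports Defs
begin

section \<open>Linear and bilinear forms on the free space\<close>

lemma linear_form_add: "linear_form f \<Longrightarrow> f (x + y) = f x + f y"
  and linear_form_scaleC: "linear_form f \<Longrightarrow> f (c *\<^sub>C x) = c * f x"
  by (simp_all add: linear_form_iff)

lemma linear_form_zero: "linear_form f \<Longrightarrow> f 0 = 0"
  using linear_form_scaleC[of f 0 0] by simp

lemma linear_form_minus: "linear_form f \<Longrightarrow> f (- x) = - f x"
  using linear_form_scaleC[of f "-1" x] by (simp add: complex_vector.scale_minus_left scaleC_one)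

lemma linear_form_diff: "linear_form f \<Longrightarrow> f (x - y) = f x - f y"
  using linear_form_add[of f x "- y"] by (simp add: linear_form_minus)

lemmas linear_form_simps = linear_form_add linear_form_scaleC linear_form_zero
  linear_form_minus linear_form_diff

lemma bilinear_form_left: "bilinear_form \<psi> \<Longrightarrow> linear_form (\<lambda>x. \<psi> x y)"
  and bilinear_form_right: "bilinear_form \<psi> \<Longrightarrow> linear_form (\<psi> x)"
  by (simp_all add: bilinear_form_def)

lemmas bilinear_form_simps =
  linear_form_simps[OF bilinear_form_left] linear_form_simps[OF bilinear_form_right]

lemma bilinear_form_bracket:
  "linear_form f \<Longrightarrow> bilinear_form (\<lambda>x y. f (bracket x y))"
  by (simp add: bilinear_form_def linear_form_iff bracket_add_left bracket_add_right
      bracket_scaleC_left bracket_scaleC_right)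

lemma bilinear_form_diff:
  "bilinear_form \<phi> \<Longrightarrow> bilinear_form \<psi> \<Longrightarrow> bilinear_form (\<lambda>x y. \<phi> x y - \<psi> x y)"
  by (simp add: bilinear_form_def linear_form_iff algebra_simps)

lemma bilinear_form_lincomb:
  "(\<And>i. i \<in> I \<Longrightarrow> bilinear_form (\<phi> i)) \<Longrightarrow> bilinear_form (\<lambda>x y. \<Sum>i\<in>I. c i * \<phi> i x y)"
  by (simp add: bilinear_form_def linear_form_iff algebra_simps sum.distrib sum_distrib_left)

lemma sbar_induct [case_names zero add scale basis]:
  assumes "P 0" "\<And>x y. P x \<Longrightarrow> P y \<Longrightarrow> P (x + y)" "\<And>c x. P x \<Longrightarrow> P (c *\<^sub>C x)"
    and "\<And>a. P (bvec a)"
  shows "P x"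
proof -
  have "P (\<Sum>a\<in>A. coord x a *\<^sub>C bvec a)" if "finite A" for A
    using that by (induction A) (auto intro: assms)
  then show ?thesis
    using sbar_eq_sum_bvec[of "supp x" x] finite_supp[of x] by (metis order_refl)
qed

lemma linear_form_eqI:
  assumes "linear_form f" "linear_form g" "\<And>a. f (bvec a) = g (bvec a)"
  shows "f x = g x"
  by (induction x rule: sbar_induct) (simp_all add: assms linear_form_simps)

lemma bilinear_form_eqI:
  assumes "bilinear_form \<phi>" "bilinear_form \<psi>" "\<And>a b. \<phi> (bvec a) (bvec b) = \<psi> (bvec a) (bvec b)"
  shows "\<phi> = \<psi>"
proof (intro ext)
  fix x y
  have "\<phi> x (bvec b) = \<psi> x (bvec b)" for b
    using assms(3) by (rule linear_form_eqI[OF bilinear_form_left bilinear_form_left, OF assms(1,2)])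
  then show "\<phi> x y = \<psi> x y"
    by (rule linear_form_eqI[OF bilinear_form_right bilinear_form_right, OF assms(1,2)])
qed

section \<open>Linear and bilinear extension of prescribed basis values\<close>

definition linear_ext :: "('r sgen \<Rightarrow> complex) \<Rightarrow> 'r sbar \<Rightarrow> complex" where
  "linear_ext v x = (\<Sum>a\<in>supp x. coord x a * v a)"

lemma linear_ext_superset:
  "finite A \<Longrightarrow> supp x \<subseteq> A \<Longrightarrow> linear_ext v x = (\<Sum>a\<in>A. coord x a * v a)"
  unfolding linear_ext_def by (rule sum.mono_neutral_left) (auto simp: supp_def)

lemma linear_form_linear_ext: "linear_form (linear_ext v)"
  unfolding linear_form_iff
proof (intro conjI allI)
  fix x y :: "'a sbar" and c
  show "linear_ext v (x + y) = linear_ext v x + linear_ext v y"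
    by (subst (1 2 3) linear_ext_superset[of "supp x \<union> supp y"])
      (auto simp: finite_coord supp_def plus_sbar.rep_eq distrib_right sum.distrib)
  show "linear_ext v (c *\<^sub>C x) = c * linear_ext v x"
    by (subst (1 2) linear_ext_superset[of "supp x"])
      (auto simp: finite_coord supp_def scaleC_sbar.rep_eq sum_distrib_left mult_ac)
qed

lemma linear_ext_bvec: "linear_ext v (bvec a) = v a"
  by (subst linear_ext_superset[of "{a}"]) (auto simp: supp_def bvec.rep_eq)

lemma bilinear_form_bilinear_ext: "bilinear_form (bilinear_ext v)"
proof -
  have 1: "bilinear_ext v x y = linear_ext (\<lambda>a. linear_ext (v a) y) x" for x y
    by (simp add: bilinear_ext_def linear_ext_def sum_distrib_left mult_ac)
  \<comment> \<open>Linearity in the second argument needs the outer sum over \<open>b\<close>,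
    hence the exchange of the two finite sums.\<close>
  have 2: "bilinear_ext v x y = linear_ext (\<lambda>b. linear_ext (\<lambda>a. v a b) x) y" for x y
    unfolding bilinear_ext_def linear_ext_def
    by (subst sum.swap) (simp add: sum_distrib_left mult_ac)
  have "bilinear_ext v x = linear_ext (\<lambda>b. linear_ext (\<lambda>a. v a b) x)" for x
    by (rule ext) (rule 2)
  moreover have "(\<lambda>x. bilinear_ext v x y) = linear_ext (\<lambda>a. linear_ext (v a) y)" for y
    by (rule ext) (rule 1)
  ultimately show ?thesis
    unfolding bilinear_form_def using linear_form_linear_ext by metis
qed

section \<open>Cocycles in terms of basis values\<close>

lemma cocycles2_bilinear: "\<psi> \<in> cocycles2 \<Longrightarrow> bilinear_form \<psi>"
  by (simp add: cocycles2_def)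

lemma bvec_hpart: "bvec a \<in> hpart (sdeg (a :: 'r::gindex sgen))"
  by (cases a) (auto simp: hpart_sbar_def shpart_def supp_def bvec.rep_eq)

lemma cocycle_skew:
  "\<psi> \<in> cocycles2 \<Longrightarrow>
    \<psi> (bvec a) (bvec b) = - ((- 1) ^ (sdeg a * sdeg b)) * \<psi> (bvec b) (bvec (a :: 'r::gindex sgen))"
  using bvec_hpart[of a] bvec_hpart[of b] unfolding cocycles2_def by blast

lemma cocycle_jacobi:
  "\<psi> \<in> cocycles2 \<Longrightarrow>
    \<psi> (bvec a) (basis_bracket b c) = \<psi> (basis_bracket a b) (bvec c) +
      (- 1) ^ (sdeg a * sdeg b) * \<psi> (bvec b) (basis_bracket a (c :: 'r::gindex sgen))"
  using bvec_hpart[of a] bvec_hpart[of b] bvec_hpart[of c]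
  unfolding cocycles2_def bracket_bvec[symmetric] by blast

text \<open>All conditions are linear in each argument and the signs depend only on degrees modulo
  2, so testing basis vectors suffices.\<close>

lemma cocycles2I:
  fixes \<psi> :: "'r::gindex sbar \<Rightarrow> 'r sbar \<Rightarrow> complex"
  assumes \<psi>: "bilinear_form \<psi>"
    and skew: "\<And>a b. \<psi> (bvec a) (bvec b) = - ((- 1) ^ (sdeg a * sdeg b)) * \<psi> (bvec b) (bvec a)"
    and jacobi: "\<And>a b c. \<psi> (bvec a) (basis_bracket b c) = \<psi> (basis_bracket a b) (bvec c) +
      (- 1) ^ (sdeg a * sdeg b) * \<psi> (bvec b) (basis_bracket a c)"
  shows "\<psi> \<in> cocycles2"
proof -
  note simps = bilinear_form_simps[OF \<psi>] sbracket_zero sbracket_add_left sbracket_add_right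
    sbracket_scaleC_left sbracket_scaleC_right algebra_simps
  have "\<psi> x y = - ((- 1) ^ (i * j)) * \<psi> y x"
    if "x \<in> shpart i" "y \<in> shpart j" for x y and i j :: nat
    using that(1)
  proof (induction x rule: shpart_induct)
    case (basis a)
    show ?case
      using that(2)
    proof (induction y rule: shpart_induct)
      case (basis b)
      show ?case
        unfolding sign_mod2[of i j, symmetric]
          \<open>sdeg a = i mod 2\<close>[symmetric] \<open>sdeg b = j mod 2\<close>[symmetric]
        by (rule skew)
    qed (simp_all add: simps)
  qed (simp_all add: simps)
  moreover have "\<psi> x (sbracket y z) = \<psi> (sbracket x y) z + (- 1) ^ (i * j) * \<psi> y (sbracket x z)"
    if "x \<in> shpart i" "y \<in> shpart j" "z \<in> shpart k" for x y z and i j k :: nat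
    using that(1)
  proof (induction x rule: shpart_induct)
    case (basis a)
    show ?case
      using that(2)
    proof (induction y rule: shpart_induct)
      case (basis b)
      show ?case
      \<comment> \<open>The sign does not involve the degree of \<open>z\<close>, so the induction
        may run over all vectors.\<close>
      proof (induction z rule: sbar_induct)
        case (basis c)
        show ?case
          unfolding sign_mod2[of i j, symmetric] sbracket_bvec
            \<open>sdeg a = i mod 2\<close>[symmetric] \<open>sdeg b = j mod 2\<close>[symmetric]
          by (rule jacobi)
      qed (simp_all add: simps)
    qed (simp_all add: simps)
  qed (simp_all add: simps)
  ultimately show ?thesis
    using \<psi> unfolding cocycles2_def hpart_sbar_def bracket_sbar_def by blast
qed

lemma coboundaries2I:
  fixes \<psi> :: "'r::gindex sbar \<Rightarrow> 'r sbar \<Rightarrow> complex"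
  assumes "bilinear_form \<psi>" "linear_form f"
    and "\<And>a b. \<psi> (bvec a) (bvec b) = f (basis_bracket a b)"
  shows "\<psi> \<in> coboundaries2"
proof -
  have "\<psi> = (\<lambda>x y. f (bracket x y))"
    by (rule bilinear_form_eqI) (simp_all add: assms bilinear_form_bracket bracket_bvec)
  then show ?thesis
    using assms(2) by (auto simp: coboundaries2_def)
qed

lemma cocycles2_diff:
  "\<phi> \<in> cocycles2 \<Longrightarrow> \<psi> \<in> cocycles2 \<Longrightarrow> (\<lambda>x y. \<phi> x y - \<psi> x y) \<in> cocycles2"
  using cocycles2_add[OF _ cocycles2_scale, of \<phi> \<psi> "-1"] by simp

lemma cocycles2_lincomb:
  "finite I \<Longrightarrow> (\<And>i. i \<in> I \<Longrightarrow> \<phi> i \<in> cocycles2) \<Longrightarrow> (\<lambda>x y. \<Sum>i\<in>I. c i * \<phi> i x y) \<in> cocycles2"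
  by (induction I rule: finite_induct) (simp_all add: cocycles2_zero cocycles2_add cocycles2_scale)

section \<open>Bases of the second cohomology\<close>

lemma H2_class_eq_iff:
  assumes "\<phi> \<in> cocycles2" "\<psi> \<in> cocycles2"
  shows "H2_class \<phi> = H2_class \<psi> \<longleftrightarrow> (\<lambda>x y. \<phi> x y - \<psi> x y) \<in> coboundaries2"
  using Quotient_rel[OF Quotient_H2, of \<phi> \<psi>] assms
  by (auto simp: cohomologous_refl_iff) (auto simp: cohomologous_def)

lemma H2_class_lincomb:
  assumes "finite I" "\<And>i. i \<in> I \<Longrightarrow> \<phi> i \<in> cocycles2"
  shows "H2_class (\<lambda>x y. \<Sum>i\<in>I. c i * \<phi> i x y) = (\<Sum>i\<in>I. c i *\<^sub>C H2_class (\<phi> i))"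
  using assms
  by (induction I rule: finite_induct)
    (simp_all add: zero_H2.abs_eq[symmetric] plus_H2.abs_eq[symmetric] scaleC_H2.abs_eq
      cohomologous_refl_iff cocycles2_scale cocycles2_lincomb)

text \<open>Independence of a set does not see repetitions. If \<open>x i = x j\<close> with
  \<open>i \<noteq> j\<close>, the coefficients 1 at \<open>i\<close> and -1 at \<open>j\<close>
  give a nontrivial relation, so injectivity follows as well.\<close>

lemma independent_familyI:
  fixes x :: "'i \<Rightarrow> 'a::complex_vector"
  assumes "finite I" and zero: "\<And>c i. (\<Sum>i\<in>I. c i *\<^sub>C x i) = 0 \<Longrightarrow> i \<in> I \<Longrightarrow> c i = 0"
  shows "inj_on x I" and "complex_vector.independent (x ` I)"
proof -
  show inj: "inj_on x I"
  proof (rule inj_onI, rule ccontr)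
    fix i j assume ij: "i \<in> I" "j \<in> I" "x i = x j" "i \<noteq> j"
    define c :: "'i \<Rightarrow> complex" where "c k = of_bool (k = i) - of_bool (k = j)" for k
    have *: "(\<Sum>k\<in>I. of_bool (k = l) *\<^sub>C x k) = x l" if "l \<in> I" for l
    proof -
      have "(\<Sum>k\<in>I. of_bool (k = l) *\<^sub>C x k) = (\<Sum>k\<in>I. if k = l then x k else 0)"
        by (rule sum.cong) (simp_all add: scaleC_one)
      then show ?thesis using \<open>finite I\<close> that by simp
    qed
    have "(\<Sum>k\<in>I. c k *\<^sub>C x k) = 0"
      using ij by (simp add: c_def complex_vector.scale_left_diff_distrib sum_subtractf *)
    from zero[OF this ij(1)] ij(4) show False by (simp add: c_def)
  qed
  show "complex_vector.independent (x ` I)"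
  proof (rule complex_vector.independent_if_scalars_zero)
    fix f v assume "(\<Sum>v\<in>x ` I. f v *\<^sub>C v) = 0" "v \<in> x ` I"
    then show "f v = 0"
      using zero[of "\<lambda>i. f (x i)"] by (auto simp: sum.reindex[OF inj])
  qed (use \<open>finite I\<close> in simp)
qed

text \<open>A combination of classes is zero exactly when the same combination of cocycles is a
  coboundary, so a basis of the quotient can be checked on representatives.\<close>

lemma H2_basisI:
  fixes \<phi> :: "'i \<Rightarrow> 'g::lie_superalgebra \<Rightarrow> 'g \<Rightarrow> complex"
  assumes "finite I" and coc: "\<And>i. i \<in> I \<Longrightarrow> \<phi> i \<in> cocycles2"
    and indep: "\<And>c. (\<lambda>x y. \<Sum>i\<in>I. c i * \<phi> i x y) \<in> coboundaries2 \<Longrightarrow> \<forall>i\<in>I. c i = 0"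
    and span: "\<And>\<psi>. \<psi> \<in> cocycles2 \<Longrightarrow>
      \<exists>c. (\<lambda>x y. \<psi> x y - (\<Sum>i\<in>I. c i * \<phi> i x y)) \<in> coboundaries2"
  shows "inj_on (\<lambda>i. H2_class (\<phi> i)) I"
    and "complex_vector.independent ((\<lambda>i. H2_class (\<phi> i)) ` I)"
    and "complex_vector.span ((\<lambda>i. H2_class (\<phi> i)) ` I) = UNIV"
    and "complex_vector.dim (UNIV :: 'g H2 set) = card I"
proof -
  have zero: "c i = 0" if "(\<Sum>i\<in>I. c i *\<^sub>C H2_class (\<phi> i)) = 0" "i \<in> I" for c i
  proof (rule bspec[OF indep \<open>i \<in> I\<close>])
    have "H2_class (\<lambda>x y. \<Sum>i\<in>I. c i * \<phi> i x y) = H2_class (\<lambda>x y. 0)"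
      using that H2_class_lincomb[OF \<open>finite I\<close> coc] by (simp add: zero_H2.abs_eq)
    then show "(\<lambda>x y. \<Sum>i\<in>I. c i * \<phi> i x y) \<in> coboundaries2"
      by (subst (asm) H2_class_eq_iff)
        (simp_all add: cocycles2_lincomb[OF \<open>finite I\<close> coc] cocycles2_zero)
  qed
  show inj: "inj_on (\<lambda>i. H2_class (\<phi> i)) I"
    and ind: "complex_vector.independent ((\<lambda>i. H2_class (\<phi> i)) ` I)"
    using independent_familyI[OF \<open>finite I\<close>, of "\<lambda>i. H2_class (\<phi> i)"] zero by blast+
  show sp: "complex_vector.span ((\<lambda>i. H2_class (\<phi> i)) ` I) = UNIV"
  proof (intro set_eqI iffI UNIV_I)
    fix h :: "'g H2"
    show "h \<in> complex_vector.span ((\<lambda>i. H2_class (\<phi> i)) ` I)"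
    proof (induction h rule: H2.abs_induct)
      case (1 \<psi>)
      then have \<psi>: "\<psi> \<in> cocycles2" by (simp add: cohomologous_refl_iff)
      then obtain c where "(\<lambda>x y. \<psi> x y - (\<Sum>i\<in>I. c i * \<phi> i x y)) \<in> coboundaries2"
        using span by blast
      then have "H2_class \<psi> = (\<Sum>i\<in>I. c i *\<^sub>C H2_class (\<phi> i))"
        by (subst H2_class_lincomb[OF \<open>finite I\<close> coc, symmetric])
          (simp_all add: H2_class_eq_iff \<psi> cocycles2_lincomb[OF \<open>finite I\<close> coc])
      then show ?case
        by (simp add: complex_vector.span_sum complex_vector.span_scale complex_vector.span_base)
    qed
  qed
  show "complex_vector.dim (UNIV :: 'g H2 set) = card I"
    using complex_vector.dim_eq_card[OF _ ind, of UNIV] sp card_image[OF inj] by simp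
qed

section \<open>The standard cocycles\<close>

lemma gval_inject: "gval r = gval s \<longleftrightarrow> r = s"
  using inj_gval by (auto dest: injD)

lemma add_gsum_eq_0_iff:
  "m + gsum r s = 0 \<longleftrightarrow> of_int m + gval r + gval (s :: 'r::gindex) = 0"
  "gsum r s + m = 0 \<longleftrightarrow> of_int m + gval r + gval (s :: 'r::gindex) = 0"
  by (simp_all flip: of_int_eq_iff[where 'a = real] add: of_int_gsum algebra_simps)

text \<open>These specialise to \<open>\<alpha>1, \<dots>, \<alpha>4\<close> for the index type \<open>int\<close>; for \<open>half_int\<close> the last two
  vanish and the first two are \<open>\<beta>1\<close> and \<open>\<beta>2\<close>.\<close>

fun vir_basis :: "'r::gindex sgen \<Rightarrow> 'r sgen \<Rightarrow> complex" where
  "vir_basis (L m) (L n) = (of_int m ^ 3 - of_int m) / 12 * of_bool (m + n = 0)"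
| "vir_basis _ _ = 0"

fun lw_basis :: "'r::gindex sgen \<Rightarrow> 'r sgen \<Rightarrow> complex" where
  "lw_basis (L m) (W n) = of_bool (m + n = 0)"
| "lw_basis (W n) (L m) = - of_bool (m + n = 0)"
| "lw_basis (G r) (G s) = of_bool (gval r + gval s = 0)"
| "lw_basis _ _ = 0"

fun lg_basis :: "'r::gindex sgen \<Rightarrow> 'r sgen \<Rightarrow> complex" where
  "lg_basis (L m) (G r) = (of_int m ^ 2 + of_int m) * of_bool (of_int m + gval r = 0)"
| "lg_basis (G r) (L m) = - ((of_int m ^ 2 + of_int m) * of_bool (of_int m + gval r = 0))"
| "lg_basis _ _ = 0"

fun wg_basis :: "'r::gindex sgen \<Rightarrow> 'r sgen \<Rightarrow> complex" where
  "wg_basis (W m) (G r) = of_bool (of_int m + gval r = 0)"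
| "wg_basis (G r) (W m) = - of_bool (of_int m + gval r = 0)"
| "wg_basis _ _ = 0"

lemma vir_cocycle: "bilinear_ext vir_basis \<in> (cocycles2 :: ('r::gindex sbar \<Rightarrow> _) set)"
proof (rule cocycles2I)
  note simps = bilinear_ext_bvec bilinear_form_simps[OF bilinear_form_bilinear_ext]
  fix a b c :: "'r sgen"
  show "bilinear_ext vir_basis (bvec a) (bvec b) =
      - ((- 1) ^ (sdeg a * sdeg b)) * bilinear_ext vir_basis (bvec b) (bvec a)"
  proof (cases a; cases b)
    fix m n assume "a = L m" "b = L n"
    then show ?thesis
      by (cases "n = - m") (auto simp: simps add_eq_0_iff)
  qed (simp_all add: simps)
  show "bilinear_ext vir_basis (bvec a) (basis_bracket b c) =
      bilinear_ext vir_basis (basis_bracket a b) (bvec c) +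
      (- 1) ^ (sdeg a * sdeg b) * bilinear_ext vir_basis (bvec b) (basis_bracket a c)"
  proof (cases a; cases b; cases c)
    fix m n k assume [simp]: "a = L m" "b = L n" "c = L k"
    show ?thesis
    proof (cases "m + n + k = 0")
      case True
      then have [simp]: "k = - m - n" by simp
      show ?thesis
        by (simp add: simps power3_eq_cube field_simps)
    next
      case False
      then show ?thesis by (simp add: simps ac_simps)
    qed
  qed (simp_all add: simps)
qed (rule bilinear_form_bilinear_ext)

text \<open>All terms of one Jacobi identity carry the same delta. The coefficients for
  \<open>L m\<close>, \<open>L n\<close>, \<open>W k\<close> give n + k = (n - m) + (m + k). Those
  for \<open>L m\<close>, \<open>G r\<close>, \<open>G s\<close> give r + s on both sides, which
  forces equal constants on (L, W) and (G, G).\<close>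

lemma lw_cocycle: "bilinear_ext lw_basis \<in> (cocycles2 :: ('r::gindex sbar \<Rightarrow> _) set)"
proof (rule cocycles2I)
  note simps = bilinear_ext_bvec bilinear_form_simps[OF bilinear_form_bilinear_ext]
    gval_gshift add_gsum_eq_0_iff
  fix a b c :: "'r sgen"
  show "bilinear_ext lw_basis (bvec a) (bvec b) =
      - ((- 1) ^ (sdeg a * sdeg b)) * bilinear_ext lw_basis (bvec b) (bvec a)"
    by (cases a; cases b) (simp_all add: simps add.commute)
  show "bilinear_ext lw_basis (bvec a) (basis_bracket b c) =
      bilinear_ext lw_basis (basis_bracket a b) (bvec c) +
      (- 1) ^ (sdeg a * sdeg b) * bilinear_ext lw_basis (bvec b) (basis_bracket a c)"
    by (cases a; cases b; cases c) (auto simp: simps algebra_simps of_bool_def)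
qed (rule bilinear_form_bilinear_ext)

text \<open>For \<open>L m\<close>, \<open>L n\<close>, \<open>G r\<close> with r = -(m + n), the
  Jacobi identity is, up to the factor m + n, the equation m^2 + m - n^2 - n = (m - n) (m + n +
  1).\<close>

lemma lg_cocycle: "bilinear_ext lg_basis \<in> (cocycles2 :: ('r::gindex sbar \<Rightarrow> _) set)"
proof (rule cocycles2I)
  note simps = bilinear_ext_bvec bilinear_form_simps[OF bilinear_form_bilinear_ext] gval_gshift
  fix a b c :: "'r sgen"
  show "bilinear_ext lg_basis (bvec a) (bvec b) =
      - ((- 1) ^ (sdeg a * sdeg b)) * bilinear_ext lg_basis (bvec b) (bvec a)"
    by (cases a; cases b) (simp_all add: simps)
  have *: "complex_of_real (gval r) = - of_int m - of_int n"
    if "gval r + (real_of_int m + real_of_int n) = 0" for m n and r :: 'r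
  proof -
    have "gval r = - real_of_int m - real_of_int n" using that by simp
    then show ?thesis by simp
  qed
  show "bilinear_ext lg_basis (bvec a) (basis_bracket b c) =
      bilinear_ext lg_basis (basis_bracket a b) (bvec c) +
      (- 1) ^ (sdeg a * sdeg b) * bilinear_ext lg_basis (bvec b) (basis_bracket a c)"
    by (cases a; cases b; cases c; auto simp: simps of_bool_def power2_eq_square algebra_simps)
      (subst *, assumption, simp add: algebra_simps)+
qed (rule bilinear_form_bilinear_ext)

text \<open>\<open>L m\<close>, \<open>W n\<close>, \<open>G r\<close> require m + n + r = 0, and
  three odd vectors \<open>G r\<close>, \<open>G s\<close>, \<open>G t\<close> require 2 (r + s + t)
  = 0. Both hold on the support.\<close>

lemma wg_cocycle: "bilinear_ext wg_basis \<in> (cocycles2 :: ('r::gindex sbar \<Rightarrow> _) set)"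
proof (rule cocycles2I)
  note simps = bilinear_ext_bvec bilinear_form_simps[OF bilinear_form_bilinear_ext]
    gval_gshift of_int_gsum
  fix a b c :: "'r sgen"
  show "bilinear_ext wg_basis (bvec a) (bvec b) =
      - ((- 1) ^ (sdeg a * sdeg b)) * bilinear_ext wg_basis (bvec b) (bvec a)"
    by (cases a; cases b) (simp_all add: simps)
  have *: "complex_of_real (gval r) = - of_int m - of_int n"
    if "gval r + (real_of_int m + real_of_int n) = 0" for m n and r :: 'r
  proof -
    have "gval r = - real_of_int m - real_of_int n" using that by simp
    then show ?thesis by simp
  qed
  have **: "complex_of_real (gval r) = - of_real (gval s) - of_real (gval t)"
    if "gval r + (gval s + gval t) = 0" for r s t :: 'r
  proof -
    have "gval r = - gval s - gval t" using that by simp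
    then show ?thesis by simp
  qed
  show "bilinear_ext wg_basis (bvec a) (basis_bracket b c) =
      bilinear_ext wg_basis (basis_bracket a b) (bvec c) +
      (- 1) ^ (sdeg a * sdeg b) * bilinear_ext wg_basis (bvec b) (basis_bracket a c)"
    by (cases a; cases b; cases c; auto simp: simps of_bool_def algebra_simps)
      ((subst *, assumption, simp add: algebra_simps)+, subst **, assumption, simp)
qed (rule bilinear_form_bilinear_ext)

section \<open>Cocycles of weight zero\<close>

text \<open>The eigenvalue of the bracket with \<open>L 0\<close>, real in order to cover
  half-integral odd indices.\<close>

primrec wt :: "'r::gindex sgen \<Rightarrow> real" where
  "wt (L m) = of_int m"
| "wt (W m) = of_int m"
| "wt (G r) = gval r"

text \<open>The index -r, written as r - 2r because only integer shifts act on the index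
  type.\<close>

abbreviation gneg :: "'r::gindex \<Rightarrow> 'r" where
  "gneg r \<equiv> gshift (- gsum r r) r"

lemma gval_gneg: "gval (gneg r) = - gval (r :: 'r::gindex)"
  by (simp add: gval_gshift of_int_gsum)

lemma gneg_gneg: "gneg (gneg r) = (r :: 'r::gindex)"
  by (simp add: gval_gneg gval_inject[symmetric])

text \<open>Supplies nonzero odd indices for either index type.\<close>

lemma ex_gval_ge: "\<exists>s :: 'r::gindex. gval s \<ge> x"
proof -
  obtain k :: int where "x - gval (undefined :: 'r) \<le> of_int k"
    using ex_le_of_int by blast
  then show ?thesis
    by (intro exI[of _ "gshift k undefined"]) (simp add: gval_gshift)
qed

locale weight_zero_cocycle =
  fixes \<psi> :: "'r::gindex sbar \<Rightarrow> 'r sbar \<Rightarrow> complex"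
  assumes cocycle: "\<psi> \<in> cocycles2"
    and weight: "\<And>a b. wt a + wt b \<noteq> 0 \<Longrightarrow> \<psi> (bvec a) (bvec b) = 0"
begin

section \<open>Values on pairs of vectors of equal parity, and the pairs (L, W)\<close>

abbreviation v :: "'r sgen \<Rightarrow> 'r sgen \<Rightarrow> complex" where
  "v a b \<equiv> \<psi> (bvec a) (bvec b)"

lemmas simps = bilinear_form_simps[OF cocycles2_bilinear, OF cocycle]
lemmas skew = cocycle_skew[OF cocycle]
lemmas jacobi = cocycle_jacobi[OF cocycle]

text \<open>The Jacobi identity for \<open>L m\<close>, \<open>L 1\<close>,
  \<open>L (- 1 - m)\<close> has one term proportional to the value on (\<open>L 1\<close>,
  \<open>L (- 1)\<close>). With that value zero, it is a first-order recursion in m.\<close>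

lemma v_LL:
  assumes "v (L 1) (L (- 1)) = 0"
  shows "v (L m) (L n) = 2 * v (L 2) (L (- 2)) * vir_basis (L m) (L n :: 'r sgen)"
proof -
  have sk: "v (L m) (L n) = - v (L n) (L m)" for m n
    using skew[of "L m" "L n"] by simp
  have rec: "(of_int m - 1) * v (L (m + 1)) (L (- (m + 1))) = (of_int m + 2) * v (L m) (L (- m))" for m
    using jacobi[of "L m" "L 1" "L (- 1 - m)"] sk[of "- 1 - m" "m + 1"] assms
    by (simp add: simps algebra_simps)
  \<comment> \<open>The factor m - 1 in \<open>rec\<close> vanishes at m = 1, so the value at 2 is
    free and the induction starts there. The 6 is m^3 - m at m = 2.\<close>
  have pos: "v (L m) (L (- m)) = v (L 2) (L (- 2)) / 6 * (of_int m ^ 3 - of_int m)" if "m \<ge> 2" for m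
    using that
  proof (induction m rule: int_ge_induct)
    case (step m)
    then have "complex_of_int (m - 1) \<noteq> 0" by (subst of_int_eq_0_iff) simp
    then have "complex_of_int m - 1 \<noteq> 0" by simp
    moreover have "(of_int m - 1) * v (L (m + 1)) (L (- (m + 1))) =
        (of_int m - 1) * (v (L 2) (L (- 2)) / 6 * (of_int (m + 1) ^ 3 - of_int (m + 1)))"
      unfolding rec step.IH by (simp add: power3_eq_cube field_simps)
    ultimately show ?case by (metis mult_left_cancel)
  qed (simp add: power3_eq_cube)
  have nonneg: "v (L m) (L (- m)) = v (L 2) (L (- 2)) / 6 * (of_int m ^ 3 - of_int m)" if "m \<ge> 0" for m
  proof -
    consider "m = 0" | "m = 1" | "m \<ge> 2" using \<open>m \<ge> 0\<close> by linarith
    then show ?thesis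
    proof cases
      case 1
      then show ?thesis using sk[of 0 0] by simp
    qed (use assms pos in simp_all)
  qed
  have "v (L m) (L (- m)) = v (L 2) (L (- 2)) / 6 * (of_int m ^ 3 - of_int m)"
  proof (cases "m \<ge> 0")
    case False
    then show ?thesis
      using nonneg[of "- m"] sk[of m "- m"] by (simp add: algebra_simps)
  qed (rule nonneg)
  then show ?thesis
    using weight[of "L m" "L n"]
    by (cases "m + n = 0") (auto simp: add_eq_0_iff simp flip: of_int_add)
qed

text \<open>Shifting by -(r + s) sends r to -s and s to -r, so the Jacobi identity for
  \<open>L (- gsum r s)\<close>, \<open>G r\<close>, \<open>G s\<close> links the (L, W) values to
  the (G, G) values.\<close>

lemma v_GG_eq:
  "of_real (gval r + gval s) * v (L (- gsum r s)) (W (gsum r s)) =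
    of_real (gval r) * v (G s) (G (gneg s)) + of_real (gval s) * v (G r) (G (gneg r))"
proof -
  have "gshift (- gsum r s) r = gneg s" "gshift (- gsum r s) s = gneg r"
    by (simp_all add: gval_inject[symmetric] gval_gneg) (simp_all add: gval_gshift of_int_gsum)
  then show ?thesis
    using jacobi[of "L (- gsum r s)" "G r" "G s"] skew[of "G s" "G (gneg s)"]
    by (simp add: simps)
qed

text \<open>Super skew-symmetry is symmetry on odd vectors.\<close>

lemma v_GG_even: "v (G (gneg r)) (G (gneg (gneg r))) = v (G r) (G (gneg r))"
  using skew[of "G r" "G (gneg r)"] by (simp add: gneg_gneg)

text \<open>The bracket of \<open>L m\<close> and \<open>L (- m)\<close> is -2m times
  \<open>L 0\<close>, which brings in the value on (\<open>L 0\<close>, \<open>W 0\<close>).\<close>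

lemma v_LW_sum:
  assumes "m \<noteq> 0"
  shows "v (L m) (W (- m)) + v (L (- m)) (W m) = 2 * v (L 0) (W 0)"
proof -
  have "of_int m * (v (L m) (W (- m)) + v (L (- m)) (W m)) = of_int m * (2 * v (L 0) (W 0))"
    using jacobi[of "L m" "L (- m)" "W 0"] by (simp add: simps algebra_simps)
  then show ?thesis using assms by simp
qed

text \<open>The symmetry of \<open>\<psi>\<close> on the odd part makes \<open>v (L m) (W (- m))\<close> symmetric under
  \<open>m \<mapsto> - m\<close> for \<open>m = 2 r\<close>; this excludes the solution \<open>v (L m) (W (- m)) = m\<close>
  of the Jacobi identities involving only \<open>L\<close> and \<open>W\<close>.\<close>

lemma v_GG_nonzero:
  assumes "gval r \<noteq> 0"
  shows "v (G r) (G (gneg r)) = v (L 0) (W 0)"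
proof -
  \<comment> \<open>This is \<open>v_GG_eq\<close> with s = r, divided by 2r.\<close>
  have *: "v (L (- gsum r r)) (W (gsum r r)) = v (G r) (G (gneg r))" if "gval r \<noteq> 0" for r
  proof -
    have "complex_of_real (gval r) \<noteq> 0" using that by simp
    moreover have "of_real (gval r) * v (L (- gsum r r)) (W (gsum r r)) =
        of_real (gval r) * v (G r) (G (gneg r))"
      using v_GG_eq[of r r] by (simp add: algebra_simps)
    ultimately show ?thesis by (metis mult_left_cancel)
  qed
  have neg: "gsum (gneg r) (gneg r) = - gsum r r"
    by (simp add: gval_gneg of_int_gsum flip: of_int_eq_iff[where 'a = real])
  have "gsum r r \<noteq> 0"
    using assms by (simp add: of_int_gsum flip: of_int_eq_iff[where 'a = real])
  \<comment> \<open>By evenness both summands equal \<open>v (G r) (G (gneg r))\<close>.\<close>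
  from v_LW_sum[OF this] show ?thesis
    using *[of r] *[of "gneg r"] v_GG_even[of r] assms by (simp add: neg gval_gneg)
qed

lemma v_LW: "v (L m) (W n) = v (L 0) (W 0) * lw_basis (L m) (W n :: 'r sgen)"
proof -
  have "v (L m) (W (- m)) = v (L 0) (W 0)" if "m \<noteq> 0"
  proof -
    \<comment> \<open>An arbitrary m need not be twice an odd index. It is split as -m = r + s
      instead; the bound makes s positive and r negative, so \<open>v_GG_nonzero\<close> applies to
      both.\<close>
    obtain s :: 'r where s: "gval s \<ge> \<bar>of_int m\<bar> + 1" using ex_gval_ge by blast
    define r where "r = gneg (gshift m s)"
    have r: "gval r = - of_int m - gval s" by (simp add: r_def gval_gneg) (simp add: gval_gshift)
    have "gval r \<noteq> 0" "gval s \<noteq> 0" using r s by auto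
    moreover have "gsum r s = - m"
      by (simp add: r of_int_gsum flip: of_int_eq_iff[where 'a = real])
    ultimately show ?thesis
      using v_GG_eq[of r s] that by (simp add: v_GG_nonzero r algebra_simps)
  qed
  then show ?thesis
    using weight[of "L m" "W n"]
    by (cases "m + n = 0"; cases "m = 0") (auto simp: add_eq_0_iff simp flip: of_int_add)
qed

lemma v_GG: "v (G r) (G s) = v (L 0) (W 0) * lw_basis (G r) (G s)"
proof (cases "gval r + gval s = 0")
  case True
  then have s: "s = gneg r"
    by (simp add: gval_inject[symmetric] gval_gneg)
  have "v (G r) (G (gneg r)) = v (L 0) (W 0)"
  proof (cases "gval r = 0")
    case True
    \<comment> \<open>\<open>v_GG_nonzero\<close> does not reach index zero. In
      \<open>v_GG_eq\<close> with a nonzero t, the term with factor r drops out and t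
      cancels.\<close>
    obtain t :: 'r where t: "gval t \<ge> 1" using ex_gval_ge by blast
    have "v (L (- gsum r t)) (W (gsum r t)) = v (L 0) (W 0)"
      using v_LW[of "- gsum r t" "gsum r t"] by simp
    then have "of_real (gval t) * v (L 0) (W 0) = of_real (gval t) * v (G r) (G (gneg r))"
      using v_GG_eq[of r t] True by simp
    then show ?thesis using t by simp
  qed (rule v_GG_nonzero)
  then show ?thesis using True by (simp add: s)
qed (use weight[of "G r" "G s"] in simp)

text \<open>For m nonzero, \<open>W m\<close> is a multiple of the bracket of \<open>L m\<close> and
  \<open>W 0\<close>, while \<open>L m\<close> and \<open>W (- m)\<close> have bracket zero.\<close>

lemma v_WW: "v (W m) (W n) = 0"
proof -
  have "v (W 0) (W 0) = 0" using skew[of "W 0" "W 0"] by simp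
  moreover have "v (W m) (W (- m)) = 0" if "m \<noteq> 0"
    using jacobi[of "L m" "W 0" "W (- m)"] that by (simp add: simps)
  ultimately show ?thesis
    using weight[of "W m" "W n"]
    by (cases "m + n = 0"; cases "m = 0") (auto simp: add_eq_0_iff simp flip: of_int_add)
qed

section \<open>Values on pairs of one even and one odd vector\<close>

lemma eq_gshift_zeroI: "gval z = 0 \<Longrightarrow> of_int m + gval r = 0 \<Longrightarrow> r = gshift (- m) (z :: 'r)"
  by (simp add: gval_inject[symmetric] gval_gshift)

lemma gval_gshift_neg: "of_int m + gval r = 0 \<Longrightarrow> gval (gshift m (r :: 'r)) = 0"
  by (simp add: gval_gshift)

text \<open>If no odd index is zero, no such pair has weight zero. Otherwise the Jacobi identity for
  \<open>L m\<close>, \<open>L n\<close>, \<open>G\<close> gives a functional equation, and n = -1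
  turns it into a recursion.\<close>

lemma v_LG:
  assumes "\<And>r. gval r = 1 \<Longrightarrow> v (L (- 1)) (G r) = 0"
  shows "\<exists>c. \<forall>m r. v (L m) (G r) = c * lg_basis (L m) (G r)"
proof (cases "\<exists>z :: 'r. gval z = 0")
  case True
  then obtain z :: 'r where z: "gval z = 0" by blast
  define g where "g m = v (L m) (G (gshift (- m) z))" for m
  have eq: "of_int (m + n) * (g n - g m) = of_int (n - m) * g (m + n)" for m n
    using jacobi[of "L m" "L n" "G (gshift (- m - n) z)"] z
    by (simp add: simps g_def gshift_gshift gval_gshift algebra_simps)
  have "g (- 1) = 0" using assms z by (simp add: g_def gval_gshift)
  have "g 0 = 0" using eq[of 0 1] eq[of "-1" 1] by simp
  have down: "(of_int m + 1) * g (m - 1) = (of_int m - 1) * g m" for m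
    using eq[of m "-1"] \<open>g (- 1) = 0\<close> by (simp add: algebra_simps)
  have up: "of_int m * g (m + 1) = (of_int m + 2) * g m" for m
    using down[of "m + 1"] by (simp add: algebra_simps)
  \<comment> \<open>The recursions break down at -1 and 0, leaving the branches m \<ge> 1 and m
    \<le> -2. This equation ties them together; m^2 + m is 2 at both 1 and -2.\<close>
  have "g (- 2) = g 1" using eq[of "-2" 1] \<open>g (- 1) = 0\<close> by simp
  have pos: "g m = g 1 / 2 * (of_int m ^ 2 + of_int m)" if "m \<ge> 1" for m
    using that
  proof (induction m rule: int_ge_induct)
    case (step m)
    then have "complex_of_int m \<noteq> 0" by simp
    moreover have "of_int m * g (m + 1) = of_int m * (g 1 / 2 * (of_int (m + 1) ^ 2 + of_int (m + 1)))"
      unfolding up step.IH by (simp add: power2_eq_square field_simps)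
    ultimately show ?case by (metis mult_left_cancel)
  qed simp
  have neg: "g m = g 1 / 2 * (of_int m ^ 2 + of_int m)" if "m \<le> - 2" for m
    using that
  proof (induction m rule: int_le_induct)
    case (step m)
    then have "complex_of_int (m + 1) \<noteq> 0" by (subst of_int_eq_0_iff) simp
    then have "complex_of_int m + 1 \<noteq> 0" by simp
    moreover have "(of_int m + 1) * g (m - 1) =
        (of_int m + 1) * (g 1 / 2 * (of_int (m - 1) ^ 2 + of_int (m - 1)))"
      unfolding down step.IH by (simp add: power2_eq_square field_simps)
    ultimately show ?case by (metis mult_left_cancel)
  qed (simp add: \<open>g (- 2) = g 1\<close>)
  have g: "g m = g 1 / 2 * (of_int m ^ 2 + of_int m)" for m
  proof -
    consider "m \<ge> 1" | "m = 0" | "m = - 1" | "m \<le> - 2" by linarith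
    then show ?thesis
      by cases (use pos neg \<open>g 0 = 0\<close> \<open>g (- 1) = 0\<close> in simp_all)
  qed
  have "v (L m) (G r) = g 1 / 2 * lg_basis (L m) (G r)" for m r
  proof (cases "of_int m + gval r = 0")
    case True
    then show ?thesis
      using g[of m] eq_gshift_zeroI[OF z True] by (simp add: g_def)
  qed (use weight[of "L m" "G r"] in simp)
  then show ?thesis by blast
next
  case False
  then have "of_int m + gval r \<noteq> 0" for m and r :: 'r
    using gval_gshift_neg by blast
  then show ?thesis using weight[of "L m" "G r" for m r] by simp
qed

text \<open>The Jacobi identity for \<open>L m\<close>, \<open>W 0\<close>, \<open>G\<close> of
  index -m compares the value at m with the value at 0, both with factor m.\<close>

lemma v_WG: "\<exists>c. \<forall>m r. v (W m) (G r) = c * wg_basis (W m) (G r)"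
proof (cases "\<exists>z :: 'r. gval z = 0")
  case True
  then obtain z :: 'r where z: "gval z = 0" by blast
  have *: "v (W m) (G (gshift (- m) z)) = v (W 0) (G z)" for m
  proof (cases "m = 0")
    case False
    then show ?thesis
      using jacobi[of "L m" "W 0" "G (gshift (- m) z)"] z eq_gshift_zeroI[OF z, of 0 z]
      by (simp add: simps gshift_gshift gval_gshift)
  qed (use eq_gshift_zeroI[OF z, of 0 z] z in simp)
  have "v (W m) (G r) = v (W 0) (G z) * wg_basis (W m) (G r)" for m r
  proof (cases "of_int m + gval r = 0")
    case True
    then show ?thesis
      using *[of m] eq_gshift_zeroI[OF z True] by simp
  qed (use weight[of "W m" "G r"] in simp)
  then show ?thesis by blast
next
  case False
  then have "of_int m + gval r \<noteq> 0" for m and r :: 'r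
    using gval_gshift_neg by blast
  then show ?thesis using weight[of "W m" "G r" for m r] by simp
qed

lemma classification:
  assumes "v (L 1) (L (- 1)) = 0" "\<And>r. gval r = 1 \<Longrightarrow> v (L (- 1)) (G r) = 0"
  shows "\<exists>c1 c2 c3 c4. \<forall>a b. v a b =
    c1 * vir_basis a b + c2 * lw_basis a b + c3 * lg_basis a b + c4 * wg_basis a b"
proof -
  obtain c3 where c3: "v (L m) (G r) = c3 * lg_basis (L m) (G r)" for m r
    using v_LG[OF assms(2)] by blast
  obtain c4 where c4: "v (W m) (G r) = c4 * wg_basis (W m) (G r)" for m r
    using v_WG by blast
  have "v a b = 2 * v (L 2) (L (- 2)) * vir_basis a b + v (L 0) (W 0) * lw_basis a b +
      c3 * lg_basis a b + c4 * wg_basis a b" for a b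
  proof (cases a; cases b)
    fix m n assume "a = L m" "b = L n"
    then show ?thesis using v_LL[OF assms(1)] by simp
  next
    fix m n assume "a = L m" "b = W n"
    then show ?thesis using v_LW[of m n] by simp
  next
    fix m r assume "a = L m" "b = G r"
    then show ?thesis using c3 by simp
  next
    fix m n assume "a = W m" "b = L n"
    then show ?thesis using v_LW[of n m] skew[of "W m" "L n"] by (simp add: add.commute)
  next
    fix m n assume "a = W m" "b = W n"
    then show ?thesis using v_WW by simp
  next
    fix m r assume "a = W m" "b = G r"
    then show ?thesis using c4 by simp
  next
    fix r m assume "a = G r" "b = L m"
    then show ?thesis using c3[of m r] skew[of "G r" "L m"] by simp
  next
    fix r m assume "a = G r" "b = W m"
    then show ?thesis using c4[of m r] skew[of "G r" "W m"] by simp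
  next
    fix r s assume "a = G r" "b = G s"
    then show ?thesis using v_GG[of r s] by simp
  qed
  then show ?thesis by blast
qed

end

section \<open>The second cohomology\<close>

text \<open>Ordered so that the half-integral case is the restriction to indices below 2.\<close>

fun std_basis :: "nat \<Rightarrow> 'r::gindex sgen \<Rightarrow> 'r sgen \<Rightarrow> complex" where
  "std_basis 0 = vir_basis"
| "std_basis (Suc 0) = lw_basis"
| "std_basis (Suc (Suc 0)) = lg_basis"
| "std_basis _ = wg_basis"

abbreviation std_cocycle :: "nat \<Rightarrow> 'r::gindex sbar \<Rightarrow> 'r sbar \<Rightarrow> complex" where
  "std_cocycle i \<equiv> bilinear_ext (std_basis i)"

lemma std_cocycle_cocycles2: "std_cocycle i \<in> cocycles2"
  by (cases i rule: std_basis.cases) (simp_all add: vir_cocycle lw_cocycle lg_cocycle wg_cocycle)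

lemma lessThan_4_nat: "{..<4::nat} = {0, 1, 2, 3}"
  by auto

lemma std_cocycles_span:
  fixes \<psi> :: "'r::gindex sbar \<Rightarrow> 'r sbar \<Rightarrow> complex"
  assumes \<psi>: "\<psi> \<in> cocycles2"
  shows "\<exists>c. (\<lambda>x y. \<psi> x y - (\<Sum>i<4. c i * std_cocycle i x y)) \<in> coboundaries2"
proof -
  text \<open>Since \<open>L 0\<close> acts on \<open>bvec a\<close> by \<open>wt a\<close>, invariance of \<open>\<psi>\<close> under \<open>L 0\<close> expresses its
    part of nonzero weight as the coboundary of \<open>\<psi> (L 0) _ / wt\<close>. The values in weight \<open>0\<close> are
    chosen such that the difference vanishes where \<open>m\<^sup>3 - m\<close> and \<open>m\<^sup>2 + m\<close> do.\<close>
  define f where "f = linear_ext (\<lambda>a. if wt a \<noteq> 0 then \<psi> (bvec (L 0)) (bvec a) / of_real (wt a)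
    else case a of L m \<Rightarrow> - \<psi> (bvec (L 1)) (bvec (L (- 1))) / 2
      | W m \<Rightarrow> 0
      | G r \<Rightarrow> \<psi> (bvec (L (- 1))) (bvec (G (gshift 1 r))))"
  have f: "linear_form f" by (simp add: f_def linear_form_linear_ext)
  define \<phi> where "\<phi> = (\<lambda>x y. \<psi> x y - f (bracket x y))"
  have df: "(\<lambda>x y. f (bracket x y)) \<in> coboundaries2"
    using f by (auto simp: coboundaries2_def)
  note simps = bilinear_form_simps[OF cocycles2_bilinear[OF \<psi>]] linear_form_simps[OF f]
  have nonzero: "\<psi> (bvec a) (bvec b) = f (basis_bracket a b)" if "wt a + wt b \<noteq> 0" for a b :: "'r sgen"
  proof -
    have L0: "basis_bracket (L 0) c = of_real (wt c) *\<^sub>C bvec c" for c :: "'r sgen"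
      by (cases c) (simp_all add: gshift_def gval_inject inj_gval)
    have "of_real (wt a + wt b) * \<psi> (bvec a) (bvec b) = \<psi> (bvec (L 0)) (basis_bracket a b)"
      using cocycle_jacobi[OF \<psi>, of "L 0" a b] by (simp add: L0 simps distrib_right)
    moreover have nz: "complex_of_real (wt a + wt b) \<noteq> 0" using that by (metis of_real_eq_0_iff)
    \<comment> \<open>The bracket is a multiple of a single basis vector of weight
      \<open>wt a + wt b\<close>, so the denominator in \<open>f\<close> is this weight.\<close>
    moreover from nz have "\<psi> (bvec (L 0)) (basis_bracket a b) = of_real (wt a + wt b) * f (basis_bracket a b)"
      using that
      by (cases a; cases b) (simp_all add: simps f_def linear_ext_bvec gval_gshift of_int_gsum
          add.commute linear_form_simps[OF linear_form_linear_ext])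
    ultimately show ?thesis by (metis mult_left_cancel)
  qed
  interpret \<phi>: weight_zero_cocycle \<phi>
  proof
    show "\<phi> \<in> cocycles2"
      using cocycles2_diff[OF \<psi>] df coboundaries2_subset_cocycles2 unfolding \<phi>_def by blast
    show "\<phi> (bvec a) (bvec b) = 0" if "wt a + wt b \<noteq> 0" for a b
      using nonzero[OF that] by (simp add: \<phi>_def bracket_bvec)
  qed
  \<comment> \<open>The bracket of \<open>L 1\<close> and \<open>L (- 1)\<close> is -2 times
    \<open>L 0\<close>, which explains the division by -2 in \<open>f\<close>. In \<open>2\<close>
    the bracket is the odd vector of index 0 itself.\<close>
  have 1: "\<phi> (bvec (L 1)) (bvec (L (- 1))) = 0"
    by (simp add: \<phi>_def bracket_bvec simps) (simp add: f_def linear_ext_bvec)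
  have 2: "\<phi> (bvec (L (- 1))) (bvec (G r)) = 0" if "gval r = 1" for r
  proof -
    have "gshift 1 (gshift (- 1) r) = r" by (simp add: gval_inject[symmetric] gval_gshift)
    then show ?thesis
      using that
      by (simp add: \<phi>_def bracket_bvec simps) (simp add: f_def linear_ext_bvec gval_gshift)
  qed
  obtain c1 c2 c3 c4 where c: "\<phi> (bvec a) (bvec b) =
      c1 * vir_basis a b + c2 * lw_basis a b + c3 * lg_basis a b + c4 * wg_basis a b" for a b
    using \<phi>.classification[OF 1 2] by blast
  define c where "c = (!) [c1, c2, c3, c4]"
  have "(\<lambda>x y. \<psi> x y - (\<Sum>i<4. c i * std_cocycle i x y)) \<in> coboundaries2"
  proof (rule coboundaries2I[OF _ f])
    show "bilinear_form (\<lambda>x y. \<psi> x y - (\<Sum>i<4. c i * std_cocycle i x y))"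
      by (intro bilinear_form_diff bilinear_form_lincomb bilinear_form_bilinear_ext
          cocycles2_bilinear \<psi>)
    fix a b
    have "\<psi> (bvec a) (bvec b) = \<phi> (bvec a) (bvec b) + f (basis_bracket a b)"
      by (simp add: \<phi>_def bracket_bvec)
    then show "\<psi> (bvec a) (bvec b) - (\<Sum>i<4. c i * std_cocycle i (bvec a) (bvec b)) =
        f (basis_bracket a b)"
      by (simp add: c c_def bilinear_ext_bvec lessThan_4_nat numeral_2_eq_2 numeral_3_eq_3)
  qed
  then show ?thesis by blast
qed

text \<open>For \<open>c 1\<close> and \<open>c 3\<close> the test pair has bracket zero. For
  \<open>c 0\<close> and \<open>c 2\<close> two pairs have brackets proportional to the same vector;
  the standard cocycle vanishes on one of them, which makes \<open>f\<close> zero on that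
  vector.\<close>

lemma std_cocycles_independent:
  fixes c :: "nat \<Rightarrow> complex"
  assumes "(\<lambda>x y. \<Sum>i<4. c i * std_cocycle i x (y :: 'r::gindex sbar)) \<in> coboundaries2"
  shows "c 0 = 0" "c 1 = 0"
    and "gval (z :: 'r) = 0 \<Longrightarrow> c 2 = 0" "gval (z :: 'r) = 0 \<Longrightarrow> c 3 = 0"
proof -
  obtain f where f: "linear_form f"
    and eq: "(\<lambda>x y. \<Sum>i<4. c i * std_cocycle i x (y :: 'r sbar)) = (\<lambda>x y. f (bracket x y))"
    using assms by (auto simp: coboundaries2_def)
  have c: "c 0 * vir_basis a b + c 1 * lw_basis a b + c 2 * lg_basis a b + c 3 * wg_basis a b =
      f (basis_bracket a b)" for a b :: "'r sgen"
    using fun_cong[OF fun_cong[OF eq, of "bvec a"], of "bvec b"]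
    by (simp add: bracket_bvec bilinear_ext_bvec lessThan_4_nat numeral_2_eq_2 numeral_3_eq_3 add.assoc)
  note f = linear_form_simps[OF f]
  show "c 0 = 0"
    using c[of "L 1" "L (- 1)"] c[of "L 2" "L (- 2)"] by (simp add: f)
  show "c 1 = 0"
    using c[of "L 0" "W 0"] by (simp add: f)
  assume z: "gval z = 0"
  have *: "gshift m (gshift n z) = z" if "m + n = 0" for m n
    using that by (simp add: gval_inject[symmetric] gval_gshift flip: of_int_add)
  show "c 2 = 0"
    using c[of "L 1" "G (gshift (- 1) z)"] c[of "L (- 1)" "G (gshift 1 z)"] z
    by (simp add: f gval_gshift *)
  show "c 3 = 0"
    using c[of "W 0" "G z"] z by (simp add: f)
qed

section \<open>Identification with the named cocycles of the two algebras\<close>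

lemma alpha_std_cocycle:
  "\<alpha>1 = std_cocycle 0" "\<alpha>2 = std_cocycle 1" "\<alpha>3 = std_cocycle 2" "\<alpha>4 = std_cocycle 3"
proof -
  have *: "real_of_int m + real_of_int n = 0 \<longleftrightarrow> m + n = 0" for m n
    by linarith
  have "alpha1_basis a b = vir_basis a b" "alpha2_basis a b = lw_basis a b"
    "alpha3_basis a b = lg_basis a b" "alpha4_basis a b = wg_basis a b" for a b
    by (cases a; cases b; simp add: gval_int_def *)+
  then have "alpha1_basis = vir_basis" "alpha2_basis = lw_basis"
    "alpha3_basis = lg_basis" "alpha4_basis = wg_basis"
    by blast+
  then show "\<alpha>1 = std_cocycle 0" "\<alpha>2 = std_cocycle 1" "\<alpha>3 = std_cocycle 2" "\<alpha>4 = std_cocycle 3"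
    by (simp_all add: \<alpha>1_def \<alpha>2_def \<alpha>3_def \<alpha>4_def numeral_2_eq_2 numeral_3_eq_3)
qed

text \<open>Twice the sum is an odd integer.\<close>

lemma gval_half_int_nonzero: "of_int m + gval (r :: half_int) \<noteq> 0"
proof
  assume "of_int m + gval r = 0"
  moreover obtain k :: int where "gval r = of_int k + 1/2"
    using Rep_half_int[of r] by (auto simp: gval_half_int_def)
  ultimately have "real_of_int (2 * m + 2 * k + 1) = 0" by simp
  then have "2 * m + 2 * k + 1 = 0" by (simp only: of_int_eq_0_iff)
  then show False by presburger
qed

lemma beta_std_cocycle:
  "\<beta>1 = std_cocycle 0" "\<beta>2 = std_cocycle 1"
  and half_int_std_cocycle_zero: "i \<ge> 2 \<Longrightarrow> std_cocycle i = (\<lambda>x (y :: sbar_half). 0)"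
proof -
  have "beta1_basis a b = vir_basis a b" "beta2_basis a b = lw_basis a b" for a b
    by (cases a; cases b; simp)+
  then have "beta1_basis = vir_basis" "beta2_basis = lw_basis"
    by blast+
  then show "\<beta>1 = std_cocycle 0" "\<beta>2 = std_cocycle 1"
    by (simp_all add: \<beta>1_def \<beta>2_def)
  assume "i \<ge> 2"
  then have "std_basis i a b = 0" for a b :: "half_int sgen"
    by (cases i rule: std_basis.cases; cases a; cases b) (simp_all add: gval_half_int_nonzero)
  then show "std_cocycle i = (\<lambda>x (y :: sbar_half). 0)"
    by (simp add: bilinear_ext_def fun_eq_iff)
qed

text \<open>Transfers the four-term span and independence results to the two cocycles that survive
  for half-integral indices.\<close>

lemma half_int_sum_std_cocycle:
  "(\<Sum>i<4. c i * std_cocycle i x y) = (\<Sum>i<2. c i * std_cocycle i x (y :: sbar_half))"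
  by (rule sum.mono_neutral_right) (auto simp: half_int_std_cocycle_zero)

theorem theorem3p9:
  shows "({\<alpha>1, \<alpha>2, \<alpha>3, \<alpha>4} \<subseteq> cocycles2 \<and>
     complex_vector.dim (UNIV :: sbar_zero H2 set) = 4 \<and>
     distinct [H2_class \<alpha>1, H2_class \<alpha>2, H2_class \<alpha>3, H2_class \<alpha>4] \<and>
     complex_vector.independent {H2_class \<alpha>1, H2_class \<alpha>2, H2_class \<alpha>3, H2_class \<alpha>4} \<and>
     complex_vector.span {H2_class \<alpha>1, H2_class \<alpha>2, H2_class \<alpha>3, H2_class \<alpha>4} = UNIV)
   \<and>
   ({\<beta>1, \<beta>2} \<subseteq> cocycles2 \<and>
     complex_vector.dim (UNIV :: sbar_half H2 set) = 2 \<and>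
     distinct [H2_class \<beta>1, H2_class \<beta>2] \<and>
     complex_vector.independent {H2_class \<beta>1, H2_class \<beta>2} \<and>
     complex_vector.span {H2_class \<beta>1, H2_class \<beta>2} = UNIV)"
proof (rule conjI)
  let ?h = "\<lambda>i. H2_class (std_cocycle i :: sbar_zero \<Rightarrow> _)"
  have indep: "\<forall>i\<in>{..<4}. c i = 0"
    if "(\<lambda>x y. \<Sum>i<4. c i * std_cocycle i x (y :: sbar_zero)) \<in> coboundaries2" for c
    \<comment> \<open>The integer index 0 is the zero-weight odd index required for
      \<open>c 2\<close> and \<open>c 3\<close>.\<close>
    using std_cocycles_independent(1,2)[OF that] std_cocycles_independent(3,4)[OF that, of 0]
    by (auto simp: lessThan_4_nat gval_int_def)
  have basis: "inj_on ?h {..<4}" "complex_vector.independent (?h ` {..<4})"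
    "complex_vector.span (?h ` {..<4}) = UNIV"
    "complex_vector.dim (UNIV :: sbar_zero H2 set) = card {..<4::nat}"
    by (rule H2_basisI[where \<phi> = std_cocycle, OF finite_lessThan std_cocycle_cocycles2],
        erule indep, erule std_cocycles_span)+
  have "?h ` {..<4} = {?h 0, ?h 1, ?h 2, ?h 3}"
    by (simp add: lessThan_4_nat)
  moreover have *: "{std_cocycle 0, std_cocycle 1, std_cocycle 2, std_cocycle 3} \<subseteq> (cocycles2 :: (sbar_zero \<Rightarrow> _) set)"
    using std_cocycle_cocycles2 by blast
  moreover have "distinct [?h 0, ?h 1, ?h 2, ?h 3]"
    using basis(1) unfolding lessThan_4_nat inj_on_def by auto
  ultimately show "{\<alpha>1, \<alpha>2, \<alpha>3, \<alpha>4} \<subseteq> cocycles2 \<and>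
     complex_vector.dim (UNIV :: sbar_zero H2 set) = 4 \<and>
     distinct [H2_class \<alpha>1, H2_class \<alpha>2, H2_class \<alpha>3, H2_class \<alpha>4] \<and>
     complex_vector.independent {H2_class \<alpha>1, H2_class \<alpha>2, H2_class \<alpha>3, H2_class \<alpha>4} \<and>
     complex_vector.span {H2_class \<alpha>1, H2_class \<alpha>2, H2_class \<alpha>3, H2_class \<alpha>4} = UNIV"
    using basis(2-4) * unfolding alpha_std_cocycle by simp
next
  let ?h = "\<lambda>i. H2_class (std_cocycle i :: sbar_half \<Rightarrow> _)"
  have "{..<2::nat} = {0, 1}" by auto
  have indep: "\<forall>i\<in>{..<2}. c i = 0"
    if "(\<lambda>x y. \<Sum>i<2. c i * std_cocycle i x (y :: sbar_half)) \<in> coboundaries2" for c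
    using std_cocycles_independent(1,2)[of c] that \<open>{..<2} = {0, 1}\<close>
    unfolding half_int_sum_std_cocycle[symmetric] by auto
  have span: "\<exists>c. (\<lambda>x y. \<psi> x y - (\<Sum>i<2. c i * std_cocycle i x y)) \<in> coboundaries2"
    if "\<psi> \<in> cocycles2" for \<psi> :: "sbar_half \<Rightarrow> sbar_half \<Rightarrow> complex"
    using std_cocycles_span[OF that] unfolding half_int_sum_std_cocycle .
  have basis: "inj_on ?h {..<2}" "complex_vector.independent (?h ` {..<2})"
    "complex_vector.span (?h ` {..<2}) = UNIV"
    "complex_vector.dim (UNIV :: sbar_half H2 set) = card {..<2::nat}"
    by (rule H2_basisI[where \<phi> = std_cocycle, OF finite_lessThan std_cocycle_cocycles2],
        erule indep, erule span)+
  have "?h ` {..<2} = {?h 0, ?h 1}"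
    by (simp add: \<open>{..<2} = {0, 1}\<close>)
  moreover have *: "{std_cocycle 0, std_cocycle 1} \<subseteq> (cocycles2 :: (sbar_half \<Rightarrow> _) set)"
    using std_cocycle_cocycles2 by blast
  moreover have "distinct [?h 0, ?h 1]"
    using basis(1) unfolding \<open>{..<2} = {0, 1}\<close> inj_on_def by auto
  ultimately show "{\<beta>1, \<beta>2} \<subseteq> cocycles2 \<and>
     complex_vector.dim (UNIV :: sbar_half H2 set) = 2 \<and>
     distinct [H2_class \<beta>1, H2_class \<beta>2] \<and>
     complex_vector.independent {H2_class \<beta>1, H2_class \<beta>2} \<and>
     complex_vector.span {H2_class \<beta>1, H2_class \<beta>2} = UNIV"
    using basis(2-4) * unfolding beta_std_cocycle by simp
qed

end
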